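(* Let $\Gamma \curvearrowright X$ be an action by homeomorphisms of an infinite virtually cyclic (discrete) group $\Gamma$ on a compact Hausdorff space $X$. If the action $\Gamma \curvearrowright X$ has the marker property, then $\operatorname{dad}(\Gamma \curvearrowright X) = 1$. In particular, the marker property holds, and hence $\operatorname{dad}(\Gamma \curvearrowright X) = 1$, whenever the action is free and at least one of the following holds: (1) the action $\Gamma \curvearrowright X$ is minimal; (2) $X$ has finite covering dimension.
   Context: A group is virtually cyclic if it has a cyclic subgroup of finite index. An action $\Gamma \curvearrowright X$ is free if only the identity element $e\in\Gamma$ fixes a point of $X$; it is minimal if $X$ has no proper non-empty closed $\Gamma$-invariant subset. Marker property: for a finite subset $F \subseteq \Gamma$, an open set $U \subseteq X$ is an $F$-marker if the family $\{gU : g \in F\}$ is pairwise disjoint (that is, $gU \cap hU = \emptyset$ for distinct $g,h\in F$) and $X = \bigcup_{g \in \Gamma} gU$. The action $\Gamma \curvearrowright X$ has the marker property if there exists an $F$-marker for every finite subset $F \subseteq \Gamma$. Dynamic asymptotic dimension: for an open subset $U \subseteq X$ and a finite subset $E \subseteq \Gamma$, let $F(U,E)$ be the set of all $g \in \Gamma$ for which there exist $g_1,\dots,g_n \in E$ and $x \in U$ such that $g = g_n \cdots g_2 g_1$ and $g_j \cdots g_1 x \in U$ for all $j \in \{1,\dots,n\}$. The dynamic asymptotic dimension $\operatorname{dad}(\Gamma \curvearrowright X)$ is the smallest integer $d \ge 0$ such that for every finite subset $E \subseteq \Gamma$ (which one may take to be symmetric) there is an open cover $\{U_0,\dots,U_d\}$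 of $X$ for which $F(U_i,E)$ is finite for every $0\le i\le d$; if no such $d$ exists, it is infinite. When the action is free, the finiteness of $F(U_i,E)$ for symmetric $E$ can be replaced by the requirement that the equivalence relation $\sim_{U_i,E}$ on $U_i$ has uniformly finite equivalence classes, where, for $x,y\in U$, $x \sim_{U,E} y$ if there is a finite sequence $x = x_0,x_1,\dots,x_n=y$ in $U$ such that for each $1\le j\le n$ there is $g \in E\cup E^{-1}$ with $g x_{j-1}=x_j$. *)

theory Defs
  imports "HOL-Analysis.Analysis" "HOL-Algebra.Group_Action" "HOL-Algebra.Elementary_Groups"
    "HOL-Library.Extended_Nat"
    "HOL-Library.Disjoint_Sets"
begin

definition virtually_cyclic :: "('g, 'm) monoid_scheme \<Rightarrow> bool" where
  "virtually_cyclic G \<longleftrightarrow>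
     (\<exists>H. subgroup H G \<and> cyclic_group (G\<lparr>carrier := H\<rparr>) \<and> finite (rcosets\<^bsub>G\<^esub> H))"

text \<open>The space is a topology \<open>X\<close> whose underlying set is \<open>topspace X\<close>, and \<open>\<phi> g\<close> is the map
  \<open>x \<mapsto> gx\<close> (extensional, as required by \<^const>\<open>group_action\<close>). The group is discrete, so no
  joint continuity condition is needed.\<close>

definition action_by_homeomorphisms ::
    "('g, 'm) monoid_scheme \<Rightarrow> 'x topology \<Rightarrow> ('g \<Rightarrow> 'x \<Rightarrow> 'x) \<Rightarrow> bool" where
  "action_by_homeomorphisms G X \<phi> \<longleftrightarrow>
     group_action G (topspace X) \<phi> \<and> (\<forall>g \<in> carrier G. homeomorphic_map X X (\<phi> g))"

definition free_action ::
    "('g, 'm) monoid_scheme \<Rightarrow> 'x topology \<Rightarrow> ('g \<Rightarrow> 'x \<Rightarrow> 'x) \<Rightarrow> bool" where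
  "free_action G X \<phi> \<longleftrightarrow>
     (\<forall>g \<in> carrier G. \<forall>x \<in> topspace X. \<phi> g x = x \<longrightarrow> g = \<one>\<^bsub>G\<^esub>)"

definition minimal_action ::
    "('g, 'm) monoid_scheme \<Rightarrow> 'x topology \<Rightarrow> ('g \<Rightarrow> 'x \<Rightarrow> 'x) \<Rightarrow> bool" where
  "minimal_action G X \<phi> \<longleftrightarrow>
     (\<forall>C. closedin X C \<and> C \<noteq> {} \<and> (\<forall>g \<in> carrier G. \<phi> g ` C = C) \<longrightarrow> C = topspace X)"

definition is_marker ::
    "('g, 'm) monoid_scheme \<Rightarrow> 'x topology \<Rightarrow> ('g \<Rightarrow> 'x \<Rightarrow> 'x) \<Rightarrow> 'g set \<Rightarrow> 'x set \<Rightarrow> bool" where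
  "is_marker G X \<phi> F U \<longleftrightarrow>
     openin X U \<and> disjoint_family_on (\<lambda>g. \<phi> g ` U) F \<and>
     topspace X = (\<Union>g \<in> carrier G. \<phi> g ` U)"

definition marker_property ::
    "('g, 'm) monoid_scheme \<Rightarrow> 'x topology \<Rightarrow> ('g \<Rightarrow> 'x \<Rightarrow> 'x) \<Rightarrow> bool" where
  "marker_property G X \<phi> \<longleftrightarrow>
     (\<forall>F. finite F \<and> F \<subseteq> carrier G \<longrightarrow> (\<exists>U. is_marker G X \<phi> F U))"

text \<open>\<open>left_word G s j\<close> is the product \<open>s j \<otimes> \<dots> \<otimes> s 2 \<otimes> s 1\<close>; the value \<open>s 0\<close> is not used.\<close>

primrec left_word :: "('g, 'm) monoid_scheme \<Rightarrow> (nat \<Rightarrow> 'g) \<Rightarrow> nat \<Rightarrow> 'g" where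
  "left_word G s 0 = \<one>\<^bsub>G\<^esub>"
| "left_word G s (Suc n) = s (Suc n) \<otimes>\<^bsub>G\<^esub> left_word G s n"

definition return_set ::
    "('g, 'm) monoid_scheme \<Rightarrow> ('g \<Rightarrow> 'x \<Rightarrow> 'x) \<Rightarrow> 'x set \<Rightarrow> 'g set \<Rightarrow> 'g set" where
  "return_set G \<phi> U E =
     {g \<in> carrier G. \<exists>n\<ge>1. \<exists>s. \<exists>x\<in>U. (\<forall>j\<in>{1..n}. s j \<in> E) \<and> g = left_word G s n \<and>
        (\<forall>j\<in>{1..n}. \<phi> (left_word G s j) x \<in> U)}"

definition dad_le ::
    "('g, 'm) monoid_scheme \<Rightarrow> 'x topology \<Rightarrow> ('g \<Rightarrow> 'x \<Rightarrow> 'x) \<Rightarrow> nat \<Rightarrow> bool" where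
  "dad_le G X \<phi> d \<longleftrightarrow>
     (\<forall>E. finite E \<and> E \<subseteq> carrier G \<longrightarrow>
        (\<exists>U :: nat \<Rightarrow> 'x set. (\<forall>i\<le>d. openin X (U i)) \<and> (\<Union>i\<le>d. U i) = topspace X \<and>
           (\<forall>i\<le>d. finite (return_set G \<phi> (U i) E))))"

definition dad ::
    "('g, 'm) monoid_scheme \<Rightarrow> 'x topology \<Rightarrow> ('g \<Rightarrow> 'x \<Rightarrow> 'x) \<Rightarrow> enat" where
  "dad G X \<phi> = (if \<exists>d. dad_le G X \<phi> d then enat (LEAST d. dad_le G X \<phi> d) else \<infinity>)"

text \<open>Lebesgue covering dimension (the library's \<^const>\<open>dimension_le\<close> is the small inductive
  dimension). As usual for normal spaces, finite open covers are used. The value is an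
  \<^typ>\<open>enat\<close>, so the empty space gets dimension 0 rather than -1.\<close>

definition covering_dim_le :: "'x topology \<Rightarrow> nat \<Rightarrow> bool" where
  "covering_dim_le X n \<longleftrightarrow>
     (\<forall>\<U>. finite \<U> \<and> (\<forall>U\<in>\<U>. openin X U) \<and> \<Union>\<U> = topspace X \<longrightarrow>
        (\<exists>\<V>. finite \<V> \<and> (\<forall>V\<in>\<V>. openin X V) \<and> \<Union>\<V> = topspace X \<and>
           (\<forall>V\<in>\<V>. \<exists>U\<in>\<U>. V \<subseteq> U) \<and>
           (\<forall>x\<in>topspace X. card {V \<in> \<V>. x \<in> V} \<le> n + 1)))"

definition covering_dim :: "'x topology \<Rightarrow> enat" where
  "covering_dim X =
     (if \<exists>n. covering_dim_le X n then enat (LEAST n. covering_dim_le X n) else \<infinity>)"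

end

theory Submission
  imports Defs
begin

text \<open>Marker property implies dimension one: the elements of an infinite virtually cyclic group are
  \<open>c t\<^sup>n\<close> with \<open>c\<close> from a finite set, and left multiplication by a finite set \<open>E\<close> changes the
  exponent by a bounded amount. Hence large balls around the visits of an orbit to a marker cut the orbit
  into finite pieces, while for a sparse marker the balls themselves do not meet; a neighbourhood of
  the balls and the complement of the balls form the required cover.

  Finite covering dimension implies the marker property: cover \<open>X\<close> by finitely many open sets with
  disjoint translates and build the marker greedily. The construction fails at a point only if a nearby
  point of its orbit lies on the boundary of one of these sets. If \<open>X\<close> has dimension \<open>d\<close>, then these
  boundaries can be put in general position, so that within any prescribed finite window an orbit meets
  them at most \<open>d\<close> times. A window containing \<open>d + 1\<close> disjoint regions, each large enough for the greedy
  construction, therefore has a region on which it succeeds.\<close>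

subsection \<open>Covering dimension\<close>

text \<open>Induction on \<open>I\<close>: the part of \<open>S\<close> that only \<open>U j\<close>
  covers is closed, so normality puts an open \<open>P\<close> around it whose closure lies in
  \<open>U j\<close>; the remainder \<open>S - P\<close> is covered by the other sets. The induction
  needs \<open>S\<close> to range over all closed sets.\<close>

lemma normal_space_shrinking:
  assumes "normal_space X" and "finite I" and "\<And>i. i \<in> I \<Longrightarrow> openin X (U i)"
    and "closedin X S" and "S \<subseteq> (\<Union>i\<in>I. U i)"
  shows "\<exists>C. (\<forall>i\<in>I. closedin X (C i) \<and> C i \<subseteq> U i) \<and> S \<subseteq> (\<Union>i\<in>I. C i)"
  using assms(2-5)
proof (induction I arbitrary: S rule: finite_induct)
    case empty
    then show ?case by auto
  next
    case (insert j I)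
    define R where "R = S - (\<Union>i\<in>I. U i)"
    have "openin X (\<Union>i\<in>I. U i)"
      using insert.prems(1) by auto
    then have "closedin X R"
      unfolding R_def using insert.prems(2) by blast
    moreover have "openin X (U j)" "R \<subseteq> U j"
      using insert.prems unfolding R_def by auto
    ultimately obtain P where P: "openin X P" "R \<subseteq> P" "X closure_of P \<subseteq> U j"
      using assms(1) unfolding normal_space_alt by metis
    have "\<exists>C. (\<forall>i\<in>I. closedin X (C i) \<and> C i \<subseteq> U i) \<and> S - P \<subseteq> (\<Union>i\<in>I. C i)"
    proof (rule insert.IH)
      show "closedin X (S - P)"
        using insert.prems(2) P(1) by blast
    qed (use insert.prems P(2) R_def in auto)
    then obtain C where C: "\<And>i. i \<in> I \<Longrightarrow> closedin X (C i) \<and> C i \<subseteq> U i"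
        "S - P \<subseteq> (\<Union>i\<in>I. C i)"
      by blast
    define D where "D = C(j := X closure_of P)"
    have D: "D j = X closure_of P" "\<And>i. i \<in> I \<Longrightarrow> D i = C i"
      using insert.hyps(2) by (auto simp: D_def)
    have "P \<subseteq> D j"
      by (simp add: D P(1) closure_of_subset openin_subset)
    then have "S \<subseteq> (\<Union>i\<in>insert j I. D i)"
      using C(2) D(2) by blast
    moreover have "\<forall>i\<in>insert j I. closedin X (D i) \<and> D i \<subseteq> U i"
      using C(1) P(3) D by simp
    ultimately show ?case by blast
  qed

text \<open>Ostrand's form of covering dimension. Given a cover of order \<open>\<le> d + 1\<close> and bump functions
  \<open>f V\<close> for its members, the colour of a point counts how many of the largest \<open>f V\<close> are
  strictly separated from the rest.\<close>

lemma covering_dim_le_coloured_refinement: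
  fixes X :: "'x topology"
  assumes normal: "normal_space X" and dim: "covering_dim_le X d"
    and \<U>: "finite \<U>" "\<And>U. U \<in> \<U> \<Longrightarrow> openin X U" "\<Union>\<U> = topspace X"
  shows "\<exists>\<K> :: nat \<Rightarrow> 'x set set.
    (\<forall>c. finite (\<K> c) \<and> pairwise disjnt (\<K> c) \<and> (\<forall>K\<in>\<K> c. closedin X K \<and> (\<exists>U\<in>\<U>. K \<subseteq> U))) \<and>
    (\<forall>x\<in>topspace X. \<exists>c\<le>d. x \<in> \<Union>(\<K> c))"
proof -
  have "finite \<U> \<and> (\<forall>U\<in>\<U>. openin X U) \<and> \<Union>\<U> = topspace X"
    using \<U> by blast
  then have 1: "\<exists>\<V>. finite \<V> \<and> (\<forall>V\<in>\<V>. openin X V) \<and> \<Union>\<V> = topspace X \<and>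
      (\<forall>V\<in>\<V>. \<exists>U\<in>\<U>. V \<subseteq> U) \<and> (\<forall>x\<in>topspace X. card {V \<in> \<V>. x \<in> V} \<le> d + 1)"
    by (rule dim[unfolded covering_dim_le_def, rule_format])
  then obtain \<V> where \<V>': "finite \<V> \<and> (\<forall>V\<in>\<V>. openin X V) \<and> \<Union>\<V> = topspace X \<and>
      (\<forall>V\<in>\<V>. \<exists>U\<in>\<U>. V \<subseteq> U) \<and> (\<forall>x\<in>topspace X. card {V \<in> \<V>. x \<in> V} \<le> d + 1)"
    by (rule exE)
  then have \<V>: "finite \<V>" "\<And>V. V \<in> \<V> \<Longrightarrow> openin X V" "\<Union>\<V> = topspace X"
      "\<And>V. V \<in> \<V> \<Longrightarrow> \<exists>U\<in>\<U>. V \<subseteq> U"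
      "\<And>x. x \<in> topspace X \<Longrightarrow> card {V \<in> \<V>. x \<in> V} \<le> d + 1"
   by simp_all
  have "\<exists>C. (\<forall>V\<in>\<V>. closedin X (C V) \<and> C V \<subseteq> V) \<and> topspace X \<subseteq> (\<Union>V\<in>\<V>. C V)"
    using normal_space_shrinking[OF normal \<V>(1), of "\<lambda>V. V" "topspace X"] \<V>(2,3) by simp
  then obtain C where C': "(\<forall>V\<in>\<V>. closedin X (C V) \<and> C V \<subseteq> V) \<and> topspace X \<subseteq> (\<Union>V\<in>\<V>. C V)"
    by (rule exE)
  then have C: "\<And>V. V \<in> \<V> \<Longrightarrow> closedin X (C V)" "\<And>V. V \<in> \<V> \<Longrightarrow> C V \<subseteq> V"
      "topspace X \<subseteq> (\<Union>V\<in>\<V>. C V)"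
    by simp_all
  have "\<exists>f. continuous_map X euclideanreal f \<and> (\<forall>x\<in>topspace X - V. f x = 0) \<and> (\<forall>x\<in>C V. f x = 1)
      \<and> (\<forall>x\<in>topspace X. 0 \<le> f x)" if V: "V \<in> \<V>" for V
  proof -
    have "closedin X (topspace X - V)" "disjnt (topspace X - V) (C V)"
      using \<V>(2)[OF V] C(2)[OF V] by (blast, auto simp: disjnt_def)
    then obtain f where f: "continuous_map X (top_of_set {0..1::real}) f"
        "f ` (topspace X - V) \<subseteq> {0}" "f ` C V \<subseteq> {1}"
      by (rule Urysohn_lemma[OF normal _ C(1)[OF V] _ zero_le_one])
    have f01: "continuous_map X euclideanreal f" "f ` topspace X \<subseteq> {0..1}"
      using f(1) by (auto simp: continuous_map_in_subtopology)
    have "\<forall>x\<in>topspace X - V. f x = 0" "\<forall>x\<in>C V. f x = 1" "\<forall>x\<in>topspace X. 0 \<le> f x"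
      using f(2,3) f01(2) by (simp_all add: image_subset_iff)
    with f01(1) show ?thesis by blast
  qed
  then have "\<forall>V\<in>\<V>. \<exists>f. continuous_map X euclideanreal f \<and> (\<forall>x\<in>topspace X - V. f x = 0) \<and>
      (\<forall>x\<in>C V. f x = 1) \<and> (\<forall>x\<in>topspace X. 0 \<le> f x)"
    by (rule ballI)
  from bchoice[OF this] obtain f where f': "\<forall>V\<in>\<V>. continuous_map X euclideanreal (f V) \<and>
      (\<forall>x\<in>topspace X - V. f V x = 0) \<and> (\<forall>x\<in>C V. f V x = 1) \<and> (\<forall>x\<in>topspace X. 0 \<le> f V x)"
    by (rule exE)
  have f: "\<And>V. V \<in> \<V> \<Longrightarrow> continuous_map X euclideanreal (f V)"
      "\<And>V x. V \<in> \<V> \<Longrightarrow> x \<in> topspace X - V \<Longrightarrow> f V x = (0::real)"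
      "\<And>V x. V \<in> \<V> \<Longrightarrow> x \<in> C V \<Longrightarrow> f V x = 1"
      "\<And>V x. V \<in> \<V> \<Longrightarrow> x \<in> topspace X \<Longrightarrow> 0 \<le> f V x"
    using f' by blast+
  \<comment> \<open>On \<open>W A\<close> the functions indexed by \<open>A\<close> are positive and
    strictly dominate all others. Positivity gives \<open>W A \<subseteq> V\<close> for each
    \<open>V \<in> A\<close>, so the pieces refine \<open>\<V>\<close> and hence
    \<open>\<U>\<close>.\<close>
  define W where "W A = {x \<in> topspace X. \<forall>V\<in>A. 0 < f V x \<and> (\<forall>V'\<in>\<V> - A. f V' x < f V x)}" for A
  define \<A> where "\<A> = {A. A \<subseteq> \<V> \<and> A \<noteq> {} \<and> card A \<le> d + 1}"
  have fin\<A>: "finite \<A>"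
    unfolding \<A>_def using \<V>(1) by (auto intro: finite_subset[of _ "Pow \<V>"])
  have Wopen: "openin X (W A)" if "A \<in> \<A>" for A
  proof -
    have A: "A \<subseteq> \<V>" "finite A" "finite (\<V> - A)"
      using that \<V>(1) by (auto simp: \<A>_def intro: finite_subset)
    have pos: "openin X {x \<in> topspace X. f V x \<in> {0<..}}" if "V \<in> A" for V
      using that A(1) f(1) by (intro openin_continuous_map_preimage[where Y = euclideanreal]) auto
    have less: "openin X {x \<in> topspace X. f V x - f V' x \<in> {0<..}}" if "V \<in> A" "V' \<in> \<V> - A" for V V'
      using that A(1) f(1)
      by (intro openin_continuous_map_preimage[where Y = euclideanreal] continuous_map_diff) auto
    \<comment> \<open>The factor \<open>topspace X\<close> keeps the inner intersection inside the
      space when \<open>\<V> - A\<close> is empty.\<close>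
    have "W A = (\<Inter>V\<in>A. {x \<in> topspace X. f V x \<in> {0<..}} \<inter>
        ((\<Inter>V'\<in>\<V> - A. {x \<in> topspace X. f V x - f V' x \<in> {0<..}}) \<inter> topspace X)) \<inter> topspace X"
      unfolding W_def by auto
    moreover have "openin X ((\<Inter>V'\<in>\<V> - A. {x \<in> topspace X. f V x - f V' x \<in> {0<..}}) \<inter> topspace X)"
      if "V \<in> A" for V
      by (rule openin_INT[OF A(3)], rule less[OF that])
    then have "openin X ((\<Inter>V\<in>A. {x \<in> topspace X. f V x \<in> {0<..}} \<inter>
        ((\<Inter>V'\<in>\<V> - A. {x \<in> topspace X. f V x - f V' x \<in> {0<..}}) \<inter> topspace X)) \<inter> topspace X)"
      by (intro openin_INT[OF A(2)] openin_Int[OF pos])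
    ultimately show ?thesis by (simp only:)
  qed
  have Wcover: "topspace X \<subseteq> (\<Union>A\<in>\<A>. W A)"
  proof
    fix x assume x: "x \<in> topspace X"
    \<comment> \<open>Members outside this \<open>A\<close> have value 0 at \<open>x\<close>, so
      they are strictly dominated; and \<open>A\<close> consists of members containing
      \<open>x\<close>, which bounds its size.\<close>
    define A where "A = {V \<in> \<V>. 0 < f V x}"
    obtain V where "V \<in> \<V>" "x \<in> C V"
      using C(3) x by auto
    then have "V \<in> A"
      using f(3) by (simp add: A_def)
    moreover have "A \<subseteq> {V \<in> \<V>. x \<in> V}"
      using f(2) x by (force simp: A_def)
    then have "card A \<le> d + 1"
      using \<V>(5)[OF x] card_mono[of "{V \<in> \<V>. x \<in> V}" A] \<V>(1) by simp
    ultimately have "A \<in> \<A>"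
      unfolding \<A>_def A_def by auto
    moreover have "x \<in> W A"
      using x f(4) unfolding W_def A_def by fastforce
    ultimately show "x \<in> (\<Union>A\<in>\<A>. W A)" by blast
  qed
  obtain K where K': "(\<forall>A\<in>\<A>. closedin X (K A) \<and> K A \<subseteq> W A) \<and> topspace X \<subseteq> (\<Union>A\<in>\<A>. K A)"
    using normal_space_shrinking[OF normal fin\<A> _ closedin_topspace Wcover] Wopen by blast
  then have K: "\<And>A. A \<in> \<A> \<Longrightarrow> closedin X (K A)" "\<And>A. A \<in> \<A> \<Longrightarrow> K A \<subseteq> W A"
      "topspace X \<subseteq> (\<Union>A\<in>\<A>. K A)"
    by simp_all
  show ?thesis
  \<comment> \<open>Colour \<open>c\<close> belongs to the index sets of size \<open>c + 1\<close>;
    the sizes 1 to \<open>d + 1\<close> give the colours 0 to \<open>d\<close>.\<close>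
  proof (intro exI[of _ "\<lambda>c. K ` {A \<in> \<A>. card A = Suc c}"] conjI allI ballI)
    fix c
    show "finite (K ` {A \<in> \<A>. card A = Suc c})"
      using fin\<A> by simp
    show "closedin X L" if "L \<in> K ` {A \<in> \<A>. card A = Suc c}" for L
      using that K(1) by auto
    show "\<exists>U\<in>\<U>. L \<subseteq> U" if L: "L \<in> K ` {A \<in> \<A>. card A = Suc c}" for L
    proof -
      obtain A where A: "A \<in> \<A>" "L = K A" using L by auto
      then obtain V where V: "V \<in> A" "V \<in> \<V>" by (auto simp: \<A>_def)
      have "W A \<subseteq> V"
        using f(2)[of V] V by (force simp: W_def)
      then show ?thesis using \<V>(4)[OF V(2)] A K(2) by blast
    qed
    show "pairwise disjnt (K ` {A \<in> \<A>. card A = Suc c})"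
    proof (rule pairwise_imageI)
      fix A B assume AB: "A \<in> {A \<in> \<A>. card A = Suc c}" "B \<in> {A \<in> \<A>. card A = Suc c}" "A \<noteq> B"
      then have "finite A" "finite B" "card A = card B"
        using finite_subset[OF _ \<V>(1)] by (auto simp: \<A>_def)
      \<comment> \<open>Distinct finite sets of equal size are incomparable, so on
        \<open>W A \<inter> W B\<close> each of \<open>f a\<close> and \<open>f b\<close> would have
        to exceed the other.\<close>
      then have "\<not> A \<subseteq> B" "\<not> B \<subseteq> A"
        using card_subset_eq[of B A] card_subset_eq[of A B] AB(3) by auto
      then obtain a b where ab: "a \<in> A" "a \<notin> B" "b \<in> B" "b \<notin> A" by blast
      then have "a \<in> \<V> - B" "b \<in> \<V> - A" using AB by (auto simp: \<A>_def)
      have "f b x < f a x" if "x \<in> W A" for x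
        using that ab(1) \<open>b \<in> \<V> - A\<close> unfolding W_def by blast
      moreover have "f a x < f b x" if "x \<in> W B" for x
        using that ab(3) \<open>a \<in> \<V> - B\<close> unfolding W_def by blast
      ultimately have "W A \<inter> W B = {}"
        by (meson disjoint_iff less_asym)
      then show "disjnt (K A) (K B)"
        using AB K(2) by (auto simp: disjnt_def)
    qed
  next
    show "\<exists>c\<le>d. x \<in> \<Union> (K ` {A \<in> \<A>. card A = Suc c})" if x: "x \<in> topspace X" for x
    proof -
      obtain A where A: "A \<in> \<A>" "x \<in> K A" using K(3) x by blast
      then have "card A \<noteq> 0" "card A \<le> d + 1"
        using \<V>(1) by (auto simp: \<A>_def dest: finite_subset)
      then have "card A = Suc (card A - 1)" "card A - 1 \<le> d" by auto
      then show ?thesis using A by blast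
    qed
  qed
qed

text \<open>The partition theorem of dimension theory. The sets \<open>V' j - A' j\<close> play the role of the
  partitions; keeping a pair of sets rather than a partition makes the conclusion stable under further
  enlarging of \<open>A'\<close> and shrinking of \<open>V'\<close>.\<close>

lemma covering_dim_le_partitions:
  assumes normal: "normal_space X" and dim: "covering_dim_le X d" and J: "card J = Suc d"
    and A: "\<And>j. j \<in> J \<Longrightarrow> closedin X (A j)" and V: "\<And>j. j \<in> J \<Longrightarrow> openin X (V j)"
    and AV: "\<And>j. j \<in> J \<Longrightarrow> A j \<subseteq> V j"
  shows "\<exists>A' V'. (\<forall>j\<in>J. closedin X (A' j) \<and> openin X (V' j) \<and> A j \<subseteq> A' j \<and> A' j \<subseteq> V' j \<and> V' j \<subseteq> V j) \<and>
    (\<forall>x\<in>topspace X. \<exists>j\<in>J. x \<notin> V' j - A' j)"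
proof -
  have finJ: "finite J"
    by (rule card_ge_0_finite) (simp add: J)
  obtain e where e: "bij_betw e J {0..<Suc d}"
    using ex_bij_betw_finite_nat[OF finJ] unfolding J by (rule exE)
  \<comment> \<open>One cell for every choice, at each \<open>j\<close>, between \<open>V j\<close>
    and the complement of \<open>A j\<close>. A point \<open>x\<close> lies in the cell of
    \<open>{j \<in> J. x \<in> V j}\<close>, since it avoids \<open>A j\<close> whenever it avoids
    \<open>V j\<close>.\<close>
  define O' where "O' s = (\<Inter>j\<in>J. if j \<in> s then V j else topspace X - A j) \<inter> topspace X" for s
  have O'_dich: "O' s \<subseteq> V j \<or> O' s \<inter> A j = {}" if "j \<in> J" for s j
  proof -
    have "O' s \<subseteq> (if j \<in> s then V j else topspace X - A j)"
      unfolding O'_def using that by blast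
    then show ?thesis by (cases "j \<in> s") auto
  qed
  have O'_open: "openin X (O' s)" for s
    unfolding O'_def using finJ A V by (intro openin_INT) auto
  have O'_cover: "\<Union>(O' ` Pow J) = topspace X"
  proof (intro equalityI subsetI)
    fix x assume x: "x \<in> topspace X"
    then have "x \<in> O' {j \<in> J. x \<in> V j}"
      using AV by (auto simp: O'_def)
    moreover have "{j \<in> J. x \<in> V j} \<in> Pow J" by blast
    ultimately show "x \<in> \<Union>(O' ` Pow J)" by (rule UN_I[rotated])
  qed (auto simp: O'_def)
  have O'_fin: "finite (O' ` Pow J)"
    using finJ by simp
  have O'_open': "openin X U" if "U \<in> O' ` Pow J" for U
    using that O'_open by auto
  obtain \<K> :: "nat \<Rightarrow> 'a set set" where \<K>: "(\<forall>c. finite (\<K> c) \<and> pairwise disjnt (\<K> c) \<and>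
      (\<forall>K\<in>\<K> c. closedin X K \<and> (\<exists>U\<in>O' ` Pow J. K \<subseteq> U))) \<and> (\<forall>x\<in>topspace X. \<exists>c\<le>d. x \<in> \<Union>(\<K> c))"
    using covering_dim_le_coloured_refinement[OF normal dim O'_fin _ O'_cover] O'_open' by blast
  have fin: "\<And>c. finite (\<K> c)" and closed: "\<And>c K. K \<in> \<K> c \<Longrightarrow> closedin X K"
    and refine: "\<And>c K. K \<in> \<K> c \<Longrightarrow> \<exists>s. K \<subseteq> O' s"
    and disj: "\<And>c. pairwise disjnt (\<K> c)"
    and cover: "\<And>x. x \<in> topspace X \<Longrightarrow> \<exists>c\<le>d. x \<in> \<Union>(\<K> c)"
    using \<K> by blast+
  \<comment> \<open>Colour \<open>e j\<close> serves the index \<open>j\<close>: pieces inside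
    \<open>V j\<close> are added to \<open>A j\<close>, all other pieces are removed from
    \<open>V j\<close>. Either way a piece misses \<open>V' j - A' j\<close>, and every point lies
    in a piece whose colour is at most \<open>d\<close>, hence of the form
    \<open>e j\<close>.\<close>
  define A' where "A' j = A j \<union> \<Union>{K \<in> \<K> (e j). K \<subseteq> V j}" for j
  define V' where "V' j = V j - \<Union>{K \<in> \<K> (e j). \<not> K \<subseteq> V j}" for j
  have sep: "K \<inter> A j = {}" if "K \<in> \<K> (e j)" "\<not> K \<subseteq> V j" "j \<in> J" for K j
    using refine[OF that(1)] O'_dich[OF that(3)] that(2) by blast
  show ?thesis
  proof (rule exI[of _ A'], rule exI[of _ V'], intro conjI ballI)
    fix j assume j: "j \<in> J"
    show "closedin X (A' j)"
      unfolding A'_def using A[OF j] fin closed by (intro closedin_Un closedin_Union) auto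
    show "openin X (V' j)"
      unfolding V'_def using V[OF j] fin closed by (intro openin_diff closedin_Union) auto
    show "A j \<subseteq> A' j" "V' j \<subseteq> V j"
      unfolding A'_def V'_def by auto
    show "A' j \<subseteq> V' j"
    proof
      fix x assume "x \<in> A' j"
      then consider "x \<in> A j" | K where "K \<in> \<K> (e j)" "K \<subseteq> V j" "x \<in> K"
        unfolding A'_def by blast
      then show "x \<in> V' j"
      proof cases
        case 1
        then show ?thesis using AV[OF j] sep[OF _ _ j] unfolding V'_def by blast
      next
        case 2
        then have "x \<notin> L" if "L \<in> \<K> (e j)" "\<not> L \<subseteq> V j" for L
          using pairwiseD[OF disj[of "e j"], of K L] that by (auto simp: disjnt_def)
        then show ?thesis using 2 unfolding V'_def by blast
      qed
    qed
  next
    fix x assume "x \<in> topspace X"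
    then obtain c K where c: "c \<le> d" "K \<in> \<K> c" "x \<in> K" using cover by blast
    then have "c \<in> e ` J"
      using bij_betw_imp_surj_on[OF e] by simp
    then obtain j where j: "j \<in> J" "e j = c" by blast
    then show "\<exists>j\<in>J. x \<notin> V' j - A' j"
      using c unfolding A'_def V'_def by blast
  qed
qed

subsection \<open>Virtually cyclic groups\<close>

text \<open>If \<open>inv g\<close> lies in the right coset of a representative r, then g^-1 = t^n r
  and g = r^-1 t^-n. Inverting the representatives puts the finite factor on the left, where later
  left multiplication acts on it.\<close>

lemma (in group) virtually_cyclic_cosets:
  assumes "virtually_cyclic G"
  obtains t C where "t \<in> carrier G" and "finite C" and "C \<subseteq> carrier G"
    and "\<And>g. g \<in> carrier G \<Longrightarrow> \<exists>c\<in>C. \<exists>n::int. g = c \<otimes> t [^] n"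
proof -
  obtain H where H: "subgroup H G" "cyclic_group (G\<lparr>carrier := H\<rparr>)" "finite (rcosets H)"
    using assms unfolding virtually_cyclic_def by blast
  interpret H: group "G\<lparr>carrier := H\<rparr>"
    using H(1) by (rule subgroup.subgroup_is_group) (rule is_group)
  obtain t where t: "t \<in> H" "H = range (\<lambda>n::int. t [^]\<^bsub>G\<lparr>carrier := H\<rparr>\<^esub> n)"
    using H(2) unfolding H.cyclic_group by auto
  have Hpow: "H = range (\<lambda>n::int. t [^] n)"
    using t int_pow_consistent[OF H(1) t(1)] by simp
  have tc: "t \<in> carrier G" using t(1) H(1) subgroup.subset by blast
  have "\<forall>R\<in>rcosets H. \<exists>a. a \<in> carrier G \<and> R = H #> a"
    unfolding RCOSETS_def by blast
  from bchoice[OF this] obtain r where r: "\<forall>R\<in>rcosets H. r R \<in> carrier G \<and> R = H #> r R"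
    by (rule exE)
  define C where "C = (\<lambda>R. inv (r R)) ` (rcosets H)"
  have "\<exists>c\<in>C. \<exists>n::int. g = c \<otimes> t [^] n" if g: "g \<in> carrier G" for g
  proof -
    have "inv g \<in> \<Union>(rcosets H)"
      using rcosets_part_G[OF H(1)] g by simp
    then obtain R where R: "R \<in> rcosets H" "inv g \<in> R" by blast
    then have rc: "r R \<in> carrier G" and "inv g \<in> H #> r R" using r by auto
    then obtain n :: int where n: "inv g = t [^] n \<otimes> r R"
      unfolding r_coset_def Hpow by auto
    have "g = inv (inv g)" using g by simp
    also have "\<dots> = inv (r R) \<otimes> inv (t [^] n)"
      unfolding n using rc tc by (simp add: inv_mult_group)
    also have "inv (t [^] n) = t [^] (- n)" using tc by (simp add: int_pow_neg)
    finally show ?thesis using R(1) unfolding C_def by blast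
  qed
  moreover have "finite C" "C \<subseteq> carrier G"
    unfolding C_def using H(3) r by auto
  ultimately show ?thesis using tc that by blast
qed

text \<open>A negative power is the inverse of a positive one, so finitely many positive powers
  would leave only finitely many powers in all.\<close>

lemma (in group) infinite_nat_powers:
  assumes t: "t \<in> carrier G" and inf: "infinite (range (\<lambda>n::int. t [^] n))"
  shows "infinite ((\<lambda>n::nat. t [^] n) ` {1..})"
proof
  assume fin: "finite ((\<lambda>n::nat. t [^] n) ` {1..})" (is "finite ?P")
  have "t [^] n \<in> {\<one>} \<union> ?P \<union> (\<lambda>g. inv g) ` ?P" for n :: int
  proof (cases n rule: int_cases2)
    case (nonneg k)
    then show ?thesis by (cases "k = 0") (auto simp: int_pow_int)
  next
    case (nonpos k)
    then show ?thesis using t by (cases "k = 0") (auto simp: int_pow_int int_pow_neg)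
  qed
  then have "range (\<lambda>n::int. t [^] n) \<subseteq> {\<one>} \<union> ?P \<union> (\<lambda>g. inv g) ` ?P" by blast
  then show False using inf fin finite_subset by (metis finite.emptyI finite.insertI finite_UnI finite_imageI)
qed

subsection \<open>Actions by homeomorphisms and general position\<close>

locale homeo_action = group_action G "topspace X" \<phi>
  for G :: "('g, 'm) monoid_scheme" (structure) and X :: "'x topology" and \<phi> +
  assumes homeo: "\<And>g. g \<in> carrier G \<Longrightarrow> homeomorphic_map X X (\<phi> g)"
begin

sublocale group G
  using group_hom group_hom.axioms(1) by blast

section \<open>Pointwise rules for the action\<close>

lemma act_one: "x \<in> topspace X \<Longrightarrow> \<phi> \<one> x = x"
  using id_eq_one by (metis restrict_apply')

lemma act_mult:
  "\<lbrakk>x \<in> topspace X; g \<in> carrier G; h \<in> carrier G\<rbrakk> \<Longrightarrow> \<phi> (g \<otimes> h) x = \<phi> g (\<phi> h x)"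
  by (rule composition_rule)

lemma act_closed: "\<lbrakk>g \<in> carrier G; x \<in> topspace X\<rbrakk> \<Longrightarrow> \<phi> g x \<in> topspace X"
  using element_image by blast

lemma act_inv: "\<lbrakk>g \<in> carrier G; x \<in> topspace X\<rbrakk> \<Longrightarrow> \<phi> (inv g) (\<phi> g x) = x"
  using orbit_sym_aux by blast

lemma act_inv': "\<lbrakk>g \<in> carrier G; x \<in> topspace X\<rbrakk> \<Longrightarrow> \<phi> g (\<phi> (inv g) x) = x"
  using act_inv[of "inv g" x] by simp

lemma act_cancel:
  "\<lbrakk>g \<in> carrier G; x \<in> topspace X; y \<in> topspace X\<rbrakk> \<Longrightarrow> \<phi> g x = \<phi> g y \<longleftrightarrow> x = y"
  by (metis act_inv)

lemma mem_image_act: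
  assumes "g \<in> carrier G" and "U \<subseteq> topspace X" and "y \<in> topspace X"
  shows "y \<in> \<phi> g ` U \<longleftrightarrow> \<phi> (inv g) y \<in> U"
proof
  assume "y \<in> \<phi> g ` U"
  then obtain u where "u \<in> U" "y = \<phi> g u" by blast
  then show "\<phi> (inv g) y \<in> U" using assms(1,2) act_inv by auto
next
  assume "\<phi> (inv g) y \<in> U"
  then have "\<phi> g (\<phi> (inv g) y) \<in> \<phi> g ` U" by blast
  then show "y \<in> \<phi> g ` U" using assms(1,3) act_inv' by simp
qed

lemma openin_image_act: "\<lbrakk>g \<in> carrier G; openin X U\<rbrakk> \<Longrightarrow> openin X (\<phi> g ` U)"
  using homeo homeomorphic_map_openness openin_subset by metis

lemma closedin_image_act: "\<lbrakk>g \<in> carrier G; closedin X C\<rbrakk> \<Longrightarrow> closedin X (\<phi> g ` C)"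
  using homeo homeomorphic_map_closedness closedin_subset by metis

section \<open>Disjointness of translates\<close>

definition translate_disjoint :: "'g set \<Rightarrow> 'x set \<Rightarrow> bool" where
  "translate_disjoint E U \<longleftrightarrow> (\<forall>e\<in>E. \<forall>x\<in>U. \<phi> e x \<notin> U)"

lemma translate_disjoint_subset:
  "\<lbrakk>translate_disjoint E V; U \<subseteq> V\<rbrakk> \<Longrightarrow> translate_disjoint E U"
  unfolding translate_disjoint_def by blast

text \<open>The translates g U and h U meet exactly when g^-1 h moves some point of U into U. The
  identity is removed because only distinct g and h are compared.\<close>

definition quotients :: "'g set \<Rightarrow> 'g set" where
  "quotients F = (\<lambda>(g, h). inv g \<otimes> h) ` (F \<times> F) - {\<one>}"

lemma finite_quotients: "finite F \<Longrightarrow> finite (quotients F)"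
  unfolding quotients_def by simp

lemma quotients_closed: "F \<subseteq> carrier G \<Longrightarrow> quotients F \<subseteq> carrier G - {\<one>}"
  unfolding quotients_def by auto

text \<open>Inversion exchanges g and h. The greedy construction relies on this symmetry.\<close>

lemma inv_quotients:
  assumes "F \<subseteq> carrier G" and "e \<in> quotients F"
  shows "inv e \<in> quotients F"
proof -
  obtain g h where gh: "g \<in> F" "h \<in> F" "e = inv g \<otimes> h" "e \<noteq> \<one>"
    using assms(2) unfolding quotients_def by auto
  have c: "g \<in> carrier G" "h \<in> carrier G" using gh assms(1) by auto
  then have "inv e = inv h \<otimes> g"
    using gh(3) by (simp add: inv_mult_group)
  moreover have "inv e \<noteq> \<one>"
    using gh(3,4) c by simp
  ultimately show ?thesis
    unfolding quotients_def using gh(1,2) by auto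
qed

text \<open>g x = h y holds exactly when g^-1 h sends y to x, which turns disjointness of a family
  into a condition on a single set.\<close>

lemma disjoint_translates_iff:
  assumes "F \<subseteq> carrier G" and "U \<subseteq> topspace X"
  shows "disjoint_family_on (\<lambda>g. \<phi> g ` U) F \<longleftrightarrow> translate_disjoint (quotients F) U"
proof
  assume L: "disjoint_family_on (\<lambda>g. \<phi> g ` U) F"
  show "translate_disjoint (quotients F) U"
    unfolding translate_disjoint_def
  proof (intro ballI notI)
    fix e x assume e: "e \<in> quotients F" and x: "x \<in> U" "\<phi> e x \<in> U"
    obtain g h where gh: "g \<in> F" "h \<in> F" "e = inv g \<otimes> h" "e \<noteq> \<one>"
      using e unfolding quotients_def by auto
    have c: "g \<in> carrier G" "h \<in> carrier G" using gh assms(1) by auto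
    have "g \<noteq> h" using gh(3,4) c by auto
    moreover have "\<phi> h x = \<phi> g (\<phi> e x)"
      using gh(3) c x assms(2) by (auto simp: act_mult act_inv' act_closed)
    then have "\<phi> h x \<in> \<phi> h ` U \<inter> \<phi> g ` U"
      using x by blast
    ultimately show False
      using L gh(1,2) unfolding disjoint_family_on_def by blast
  qed
next
  assume R: "translate_disjoint (quotients F) U"
  show "disjoint_family_on (\<lambda>g. \<phi> g ` U) F"
    unfolding disjoint_family_on_def
  proof (intro ballI impI, rule ccontr)
    fix g h assume gh: "g \<in> F" "h \<in> F" "g \<noteq> h" and "\<phi> g ` U \<inter> \<phi> h ` U \<noteq> {}"
    then obtain x y where xy: "x \<in> U" "y \<in> U" "\<phi> g x = \<phi> h y" by blast
    have c: "g \<in> carrier G" "h \<in> carrier G" using gh assms(1) by auto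
    have "inv g \<otimes> h \<noteq> \<one>"
      using gh(3) c by (metis inv_equality inv_inv inv_closed)
    then have "inv g \<otimes> h \<in> quotients F"
      using gh(1,2) unfolding quotients_def by auto
    moreover have "\<phi> (inv g \<otimes> h) y = x"
      using xy c assms(2) by (metis act_inv act_mult inv_closed subsetD)
    ultimately show False
      using R xy(1,2) unfolding translate_disjoint_def by blast
  qed
qed

text \<open>One step towards general position: the partition theorem is applied to the translates
  \<open>g\<^sup>-\<^sup>1 (K i)\<close> and \<open>g\<^sup>-\<^sup>1 (V i)\<close> for \<open>(g, i) \<in> J\<close>, and the result is transported to
  \<open>g D\<close>. The modifications for different \<open>g\<close> do not interfere since the sets \<open>g D\<close> are disjoint.\<close>

lemma general_position_step:
  assumes normal: "normal_space X" and dim: "covering_dim_le X d"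
    and W: "W \<subseteq> carrier G" and D: "closedin X D" and Ddisj: "disjoint_family_on (\<lambda>g. \<phi> g ` D) W"
    and J: "J \<subseteq> W \<times> I" "card J = Suc d"
    and KV: "\<And>i. i \<in> I \<Longrightarrow> closedin X (K i)" "\<And>i. i \<in> I \<Longrightarrow> openin X (V i)"
      "\<And>i. i \<in> I \<Longrightarrow> K i \<subseteq> V i"
  shows "\<exists>K' V'. (\<forall>i\<in>I. closedin X (K' i) \<and> openin X (V' i) \<and> K i \<subseteq> K' i \<and> K' i \<subseteq> V' i \<and> V' i \<subseteq> V i) \<and>
    (\<forall>x\<in>D. \<exists>(g, i)\<in>J. \<phi> g x \<notin> V' i - K' i)"
proof -
  define A where "A = (\<lambda>(g, i). {x \<in> topspace X. \<phi> g x \<in> K i})"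
  define B where "B = (\<lambda>(g, i). {x \<in> topspace X. \<phi> g x \<in> V i})"
  have cont: "continuous_map X X (\<phi> g)" if "g \<in> carrier G" for g
    using homeo[OF that] by (rule homeomorphic_imp_continuous_map)
  have Jmem: "fst j \<in> carrier G" "snd j \<in> I" if "j \<in> J" for j
    using subsetD[OF J(1) that] W by (auto simp: mem_Times_iff)
  have "\<exists>A' B'. (\<forall>j\<in>J. closedin X (A' j) \<and> openin X (B' j) \<and> A j \<subseteq> A' j \<and> A' j \<subseteq> B' j \<and> B' j \<subseteq> B j) \<and>
      (\<forall>x\<in>topspace X. \<exists>j\<in>J. x \<notin> B' j - A' j)"
  proof (rule covering_dim_le_partitions[OF normal dim J(2)])
    fix j assume j: "j \<in> J"
    show "closedin X (A j)"
      unfolding A_def case_prod_beta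
      by (rule closedin_continuous_map_preimage[OF cont[OF Jmem(1)[OF j]] KV(1)[OF Jmem(2)[OF j]]])
    show "openin X (B j)"
      unfolding B_def case_prod_beta
      by (rule openin_continuous_map_preimage[OF cont[OF Jmem(1)[OF j]] KV(2)[OF Jmem(2)[OF j]]])
    show "A j \<subseteq> B j"
      unfolding A_def B_def case_prod_beta using KV(3)[OF Jmem(2)[OF j]] by blast
  qed
  then obtain A' B' where A'B':
    "\<forall>j\<in>J. closedin X (A' j) \<and> openin X (B' j) \<and> A j \<subseteq> A' j \<and> A' j \<subseteq> B' j \<and> B' j \<subseteq> B j"
    and empty: "\<forall>x\<in>topspace X. \<exists>j\<in>J. x \<notin> B' j - A' j"
    by blast
  define S where "S i = {g. (g, i) \<in> J}" for i
  have finS: "finite (S i)" for i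
  proof (rule finite_subset)
    show "S i \<subseteq> fst ` J" unfolding S_def by (auto intro: rev_image_eqI)
    show "finite (fst ` J)" using card_ge_0_finite[of J] J(2) by simp
  qed
  have SW: "S i \<subseteq> W" for i
    using J(1) unfolding S_def by blast
  have Sc: "g \<in> carrier G" if "g \<in> S i" for g i
    using that SW W by blast
  have Dsub: "D \<subseteq> topspace X" using D closedin_subset by blast
  \<comment> \<open>Inside g D, \<open>K i\<close> receives the image of \<open>A' (g, i)\<close>
    and \<open>V i\<close> loses the image of the complement of \<open>B' (g, i)\<close>. So for x
    in D outside \<open>B' (g, i) - A' (g, i)\<close>, the point g x is outside
    \<open>V' i - K' i\<close>.\<close>
  define K' where "K' i = K i \<union> (\<Union>g\<in>S i. \<phi> g ` (A' (g, i) \<inter> D))" for i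
  define V' where "V' i = V i - (\<Union>g\<in>S i. \<phi> g ` (D - B' (g, i)))" for i
  have "closedin X (K' i)" if "i \<in> I" for i
    unfolding K'_def
  proof (intro closedin_Un KV(1)[OF that] closedin_Union finite_imageI finS)
    fix C assume "C \<in> (\<lambda>g. \<phi> g ` (A' (g, i) \<inter> D)) ` S i"
    then obtain g where "g \<in> S i" "C = \<phi> g ` (A' (g, i) \<inter> D)" by blast
    moreover from this have "closedin X (A' (g, i) \<inter> D)"
      using A'B' D unfolding S_def by blast
    ultimately show "closedin X C"
      using closedin_image_act[OF Sc] by simp
  qed
  moreover have "openin X (V' i)" if "i \<in> I" for i
    unfolding V'_def
  proof (intro openin_diff KV(2)[OF that] closedin_Union finite_imageI finS)
    fix C assume "C \<in> (\<lambda>g. \<phi> g ` (D - B' (g, i))) ` S i"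
    then obtain g where "g \<in> S i" "C = \<phi> g ` (D - B' (g, i))" by blast
    moreover from this have "closedin X (D - B' (g, i))"
      using A'B' D unfolding S_def by blast
    ultimately show "closedin X C"
      using closedin_image_act[OF Sc] by simp
  qed
  moreover have "K' i \<subseteq> V' i" if i: "i \<in> I" for i
  proof
    fix y assume y: "y \<in> K' i"
    show "y \<in> V' i"
      unfolding V'_def
    proof (intro DiffI notI)
      from y consider "y \<in> K i" | g where "g \<in> S i" "y \<in> \<phi> g ` (A' (g, i) \<inter> D)"
        unfolding K'_def by blast
      then show "y \<in> V i"
      proof cases
        case 1
        then show ?thesis using KV(3)[OF i] by blast
      next
        case 2
        then have "A' (g, i) \<subseteq> B (g, i)" using A'B' unfolding S_def by blast
        then show ?thesis using 2(2) unfolding B_def by auto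
      qed
    next
      assume "y \<in> (\<Union>g\<in>S i. \<phi> g ` (D - B' (g, i)))"
      then obtain g x where gx: "g \<in> S i" "x \<in> D" "x \<notin> B' (g, i)" "y = \<phi> g x" by blast
      have AB: "A (g, i) \<subseteq> B' (g, i)" "A' (g, i) \<subseteq> B' (g, i)"
        using A'B' gx(1) unfolding S_def by blast+
      from y consider "y \<in> K i" | h where "h \<in> S i" "y \<in> \<phi> h ` (A' (h, i) \<inter> D)"
        unfolding K'_def by blast
      then show False
      proof cases
        case 1
        then have "x \<in> A (g, i)" unfolding A_def using gx Dsub by auto
        then show ?thesis using AB(1) gx(3) by blast
      next
        case 2
        \<comment> \<open>A point added at \<open>h\<close> and removed at \<open>g\<close> lies in
          both h D and g D, so \<open>g\<close> and \<open>h\<close> agree; then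
          \<open>A' (g, i) \<subseteq> B' (g, i)\<close> is contradicted.\<close>
        have "g = h"
        proof (rule ccontr)
          assume "g \<noteq> h"
          then have "\<phi> g ` D \<inter> \<phi> h ` D = {}"
            using Ddisj SW gx(1) 2(1) unfolding disjoint_family_on_def by blast
          then show False using gx(2,4) 2(2) by blast
        qed
        then obtain x' where "x' \<in> A' (g, i)" "x' \<in> D" "\<phi> g x' = \<phi> g x" using 2(2) gx(4) by auto
        then have "x \<in> A' (g, i)"
          using act_cancel[OF Sc[OF gx(1)], of x' x] gx(2) Dsub by auto
        then show ?thesis using AB(2) gx(3) by blast
      qed
    qed
  qed
  moreover have "K i \<subseteq> K' i" "V' i \<subseteq> V i" for i
    unfolding K'_def V'_def by blast+
  moreover have "\<exists>(g, i)\<in>J. \<phi> g x \<notin> V' i - K' i" if x: "x \<in> D" for x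
  proof -
    obtain j where j: "j \<in> J" "x \<notin> B' j - A' j"
      using empty x Dsub by blast
    obtain g i where gi: "j = (g, i)" by fastforce
    have "g \<in> S i" using j(1) gi unfolding S_def by simp
    then have "\<phi> g x \<notin> V' i - K' i"
      using j(2) x unfolding gi K'_def V'_def by blast
    then show ?thesis using j(1) gi by blast
  qed
  ultimately show ?thesis
    by (intro exI[of _ K'] exI[of _ V']) simp
qed

text \<open>Apply the single step to all pairs (D, J) in turn. Earlier conclusions survive because
  \<open>K\<close> only grows and \<open>V\<close> only shrinks. In the end a point of any
  \<open>D\<close> in \<open>P\<close> meets the sets \<open>V' i - K' i\<close> for at most
  \<open>d\<close> pairs (g, i) in \<open>W \<times> I\<close>.\<close>

lemma general_position:
  assumes normal: "normal_space X" and dim: "covering_dim_le X d"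
    and W: "W \<subseteq> carrier G" "finite W" and I: "finite I" and P: "finite P"
    and D: "\<And>D. D \<in> P \<Longrightarrow> closedin X D" "\<And>D. D \<in> P \<Longrightarrow> disjoint_family_on (\<lambda>g. \<phi> g ` D) W"
    and KV: "\<And>i. i \<in> I \<Longrightarrow> closedin X (K i)" "\<And>i. i \<in> I \<Longrightarrow> openin X (V i)"
      "\<And>i. i \<in> I \<Longrightarrow> K i \<subseteq> V i"
  shows "\<exists>K' V'. (\<forall>i\<in>I. closedin X (K' i) \<and> openin X (V' i) \<and> K i \<subseteq> K' i \<and> K' i \<subseteq> V' i \<and> V' i \<subseteq> V i) \<and>
    (\<forall>D\<in>P. \<forall>x\<in>D. \<forall>J\<subseteq>W \<times> I. card J = Suc d \<longrightarrow> (\<exists>(g, i)\<in>J. \<phi> g x \<notin> V' i - K' i))"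
proof -
  define T where "T = P \<times> {J. J \<subseteq> W \<times> I \<and> card J = Suc d}"
  have "finite T"
    unfolding T_def using P W(2) I by (auto intro!: finite_cartesian_product finite_subset[of _ "Pow (W \<times> I)"])
  have "\<exists>K' V'. (\<forall>i\<in>I. closedin X (K' i) \<and> openin X (V' i) \<and> K i \<subseteq> K' i \<and> K' i \<subseteq> V' i \<and> V' i \<subseteq> V i) \<and>
      (\<forall>(D, J)\<in>T'. \<forall>x\<in>D. \<exists>(g, i)\<in>J. \<phi> g x \<notin> V' i - K' i)" if "T' \<subseteq> T" for T'
    using finite_subset[OF that \<open>finite T\<close>] that
  proof (induction T' rule: finite_induct)
    case empty
    then show ?case using KV by (intro exI[of _ K] exI[of _ V]) auto
  next
    case (insert t T')
    obtain D J where t: "t = (D, J)" by fastforce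
    have DJ: "D \<in> P" "J \<subseteq> W \<times> I" "card J = Suc d"
      using insert.prems t unfolding T_def by auto
    obtain K1 V1 where 1: "\<forall>i\<in>I. closedin X (K1 i) \<and> openin X (V1 i) \<and> K i \<subseteq> K1 i \<and> K1 i \<subseteq> V1 i \<and> V1 i \<subseteq> V i"
        "\<forall>(D, J)\<in>T'. \<forall>x\<in>D. \<exists>(g, i)\<in>J. \<phi> g x \<notin> V1 i - K1 i"
      using insert.IH insert.prems by auto
    have "\<exists>K' V'. (\<forall>i\<in>I. closedin X (K' i) \<and> openin X (V' i) \<and> K1 i \<subseteq> K' i \<and> K' i \<subseteq> V' i \<and> V' i \<subseteq> V1 i) \<and>
        (\<forall>x\<in>D. \<exists>(g, i)\<in>J. \<phi> g x \<notin> V' i - K' i)"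
      using 1 by (intro general_position_step[OF normal dim W(1) D(1)[OF DJ(1)] D(2)[OF DJ(1)] DJ(2,3)]) auto
    then obtain K2 V2 where 2: "\<forall>i\<in>I. closedin X (K2 i) \<and> openin X (V2 i) \<and> K1 i \<subseteq> K2 i \<and> K2 i \<subseteq> V2 i \<and> V2 i \<subseteq> V1 i"
        "\<forall>x\<in>D. \<exists>(g, i)\<in>J. \<phi> g x \<notin> V2 i - K2 i"
      by blast
    have "\<exists>(g, i)\<in>J'. \<phi> g x \<notin> V2 i - K2 i" if DJ': "(D', J') \<in> T'" "x \<in> D'" for D' J' x
    proof -
      obtain g i where "(g, i) \<in> J'" "\<phi> g x \<notin> V1 i - K1 i"
        using 1(2) DJ' by blast
      moreover have "i \<in> I"
        using \<open>(g, i) \<in> J'\<close> DJ'(1) insert.prems unfolding T_def by auto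
      ultimately show ?thesis using 2(1) by blast
    qed
    then have "\<forall>(D, J)\<in>insert t T'. \<forall>x\<in>D. \<exists>(g, i)\<in>J. \<phi> g x \<notin> V2 i - K2 i"
      using 2(2) t by blast
    moreover have "\<forall>i\<in>I. closedin X (K2 i) \<and> openin X (V2 i) \<and> K i \<subseteq> K2 i \<and> K2 i \<subseteq> V2 i \<and> V2 i \<subseteq> V i"
      using 1(1) 2(1) by (meson order_trans)
    ultimately show ?case by blast
  qed
  from this[OF order_refl] obtain K' V' where
    KV': "\<forall>i\<in>I. closedin X (K' i) \<and> openin X (V' i) \<and> K i \<subseteq> K' i \<and> K' i \<subseteq> V' i \<and> V' i \<subseteq> V i"
    and "\<forall>(D, J)\<in>T. \<forall>x\<in>D. \<exists>(g, i)\<in>J. \<phi> g x \<notin> V' i - K' i"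
    by blast
  then have "\<forall>D\<in>P. \<forall>x\<in>D. \<forall>J\<subseteq>W \<times> I. card J = Suc d \<longrightarrow> (\<exists>(g, i)\<in>J. \<phi> g x \<notin> V' i - K' i)"
    unfolding T_def by simp
  with KV' show ?thesis
    by (intro exI conjI)
qed

subsection \<open>Constructing markers\<close>

text \<open>The greedy construction keeps an open set \<open>M\<close> together with a closed set \<open>N \<supseteq> M\<close> that
  overestimates it, so that enlarging \<open>M\<close> outside the translates of \<open>N\<close> is an open condition. The
  error \<open>N - M\<close> is controlled by the gaps \<open>C j - U j\<close>. The window \<open>D\<close> depends only on \<open>E\<close> and \<open>n\<close>,
  which allows the \<open>U j\<close> to be put in general position with respect to it afterwards.\<close>

lemma greedy_marker:
  fixes n :: nat
  assumes E: "finite E" "E \<subseteq> carrier G" "\<forall>e\<in>E. inv e \<in> E"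
  shows "\<exists>D. finite D \<and> D \<subseteq> carrier G \<and> (\<forall>U C.
    (\<forall>i<n. openin X (U i) \<and> closedin X (C i) \<and> U i \<subseteq> C i \<and> translate_disjoint E (U i)) \<longrightarrow>
    (\<exists>M N. openin X M \<and> closedin X N \<and> M \<subseteq> N \<and> translate_disjoint E M \<and>
      (\<forall>x\<in>N - M. \<exists>g\<in>D. \<exists>j<n. \<phi> g x \<in> C j - U j) \<and>
      (\<forall>i<n. \<forall>x\<in>U i. (\<exists>g\<in>carrier G. \<phi> g x \<in> M) \<or> (\<exists>g\<in>D. \<exists>j<n. \<phi> g x \<in> C j - U j))))"
proof (induction n)
  case 0
  show ?case
    by (intro exI[of _ "{}"] conjI allI impI) (auto simp: translate_disjoint_def)
next
  case (Suc n)
  obtain D where D: "finite D" "D \<subseteq> carrier G"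
    and IH: "\<forall>U C. (\<forall>i<n. openin X (U i) \<and> closedin X (C i) \<and> U i \<subseteq> C i \<and> translate_disjoint E (U i)) \<longrightarrow>
      (\<exists>M N. openin X M \<and> closedin X N \<and> M \<subseteq> N \<and> translate_disjoint E M \<and>
        (\<forall>x\<in>N - M. \<exists>g\<in>D. \<exists>j<n. \<phi> g x \<in> C j - U j) \<and>
        (\<forall>i<n. \<forall>x\<in>U i. (\<exists>g\<in>carrier G. \<phi> g x \<in> M) \<or> (\<exists>g\<in>D. \<exists>j<n. \<phi> g x \<in> C j - U j)))"
    using Suc.IH by (elim exE conjE)
  \<comment> \<open>\<open>\<one>\<close> sees the new gap \<open>C n - U n\<close>; the products
    see an earlier gap after a first move by an element of \<open>E\<close>.\<close>
  define D' where "D' = insert \<one> (D \<union> (\<lambda>(g, e). g \<otimes> e) ` (D \<times> E))"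
  have D'c: "D' \<subseteq> carrier G" and D'fin: "finite D'"
    unfolding D'_def using D E(1,2) by auto
  have "\<exists>M N. openin X M \<and> closedin X N \<and> M \<subseteq> N \<and> translate_disjoint E M \<and>
      (\<forall>x\<in>N - M. \<exists>g\<in>D'. \<exists>j<Suc n. \<phi> g x \<in> C j - U j) \<and>
      (\<forall>i<Suc n. \<forall>x\<in>U i. (\<exists>g\<in>carrier G. \<phi> g x \<in> M) \<or> (\<exists>g\<in>D'. \<exists>j<Suc n. \<phi> g x \<in> C j - U j))"
    if UC: "\<forall>i<Suc n. openin X (U i) \<and> closedin X (C i) \<and> U i \<subseteq> C i \<and> translate_disjoint E (U i)"
    for U C :: "nat \<Rightarrow> 'x set"
  proof -
    have "\<exists>M N. openin X M \<and> closedin X N \<and> M \<subseteq> N \<and> translate_disjoint E M \<and>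
        (\<forall>x\<in>N - M. \<exists>g\<in>D. \<exists>j<n. \<phi> g x \<in> C j - U j) \<and>
        (\<forall>i<n. \<forall>x\<in>U i. (\<exists>g\<in>carrier G. \<phi> g x \<in> M) \<or> (\<exists>g\<in>D. \<exists>j<n. \<phi> g x \<in> C j - U j))"
      using IH[rule_format, of U C] UC by simp
    then obtain M N where M: "openin X M" and N: "closedin X N" and MN: "M \<subseteq> N"
      and Mdisj: "translate_disjoint E M"
      and tie: "\<forall>x\<in>N - M. \<exists>g\<in>D. \<exists>j<n. \<phi> g x \<in> C j - U j"
      and cov: "\<forall>i<n. \<forall>x\<in>U i. (\<exists>g\<in>carrier G. \<phi> g x \<in> M) \<or> (\<exists>g\<in>D. \<exists>j<n. \<phi> g x \<in> C j - U j)"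
      by (elim exE conjE)
    have Un: "openin X (U n)" "closedin X (C n)" "U n \<subseteq> C n" "translate_disjoint E (U n)"
      using UC by auto
    have sub: "M \<subseteq> topspace X" "N \<subseteq> topspace X" "U n \<subseteq> topspace X" "C n \<subseteq> topspace X"
      using M N Un openin_subset closedin_subset by blast+
    \<comment> \<open>\<open>M\<close> grows only outside the translates of the overestimate
      \<open>N\<close>, and \<open>N\<close> outside those of \<open>M\<close>. Hence
      \<open>M'\<close> is open, \<open>N'\<close> is closed, and
      \<open>M' \<subseteq> N'\<close>.\<close>
    define M' where "M' = M \<union> (U n - (\<Union>e\<in>E. \<phi> e ` N))"
    define N' where "N' = N \<union> (C n - (\<Union>e\<in>E. \<phi> e ` M))"
    have M'D: "\<And>x. x \<in> M' \<Longrightarrow> x \<in> topspace X"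
      unfolding M'_def using sub by blast
    have tie': "\<exists>g\<in>D'. \<exists>j<Suc n. \<phi> g x \<in> C j - U j" if x: "x \<in> N - M" for x
    proof -
      obtain g j where "g \<in> D" "j < n" "\<phi> g x \<in> C j - U j" using tie x by blast
      then show ?thesis unfolding D'_def using less_SucI by blast
    qed
    \<comment> \<open>Moving back by \<open>inv e\<close> leads into \<open>N - M\<close>, where
      some g in \<open>D\<close> reaches a gap; symmetry of \<open>E\<close> puts
      \<open>g \<otimes> inv e\<close> into \<open>D'\<close>.\<close>
    have tieE: "\<exists>g\<in>D'. \<exists>j<Suc n. \<phi> g x \<in> C j - U j"
      if x: "x \<in> topspace X" and e: "e \<in> E" "x \<in> \<phi> e ` (N - M)" for x e
    proof -
      have "\<phi> (inv e) x \<in> N - M"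
        using e x E(2) sub(2) mem_image_act[of e "N - M" x] by auto
      then obtain g j where g: "g \<in> D" "j < n" "\<phi> g (\<phi> (inv e) x) \<in> C j - U j"
        using tie by blast
      have "g \<otimes> inv e \<in> D'"
        unfolding D'_def using g(1) E(3) e(1) by force
      moreover have "\<phi> (g \<otimes> inv e) x = \<phi> g (\<phi> (inv e) x)"
        using g(1) D(2) e(1) E(2) x by (intro act_mult) auto
      ultimately show ?thesis using g less_SucI by metis
    qed
    have "openin X M'"
      unfolding M'_def
    proof (intro openin_Un M openin_diff Un closedin_Union finite_imageI E(1))
      fix S assume "S \<in> (\<lambda>e. \<phi> e ` N) ` E"
      then show "closedin X S" using closedin_image_act N E(2) by auto
    qed
    moreover have "closedin X N'"
      unfolding N'_def
    proof (intro closedin_Un N closedin_diff Un openin_Union)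
      fix S assume "S \<in> (\<lambda>e. \<phi> e ` M) ` E"
      then show "openin X S" using openin_image_act M E(2) by auto
    qed
    moreover have "M' \<subseteq> N'"
      unfolding M'_def N'_def using MN Un(3) by blast
    moreover have "translate_disjoint E M'"
      unfolding translate_disjoint_def
    proof (intro ballI notI)
      fix e x assume e: "e \<in> E" and x: "x \<in> M'" "\<phi> e x \<in> M'"
      have xt: "x \<in> topspace X" using x M'D by blast
      have ie: "inv e \<in> E" "x = \<phi> (inv e) (\<phi> e x)"
        using E(3) act_inv[OF _ xt] e E(2) by auto
      \<comment> \<open>Both points old, one old and one new, or both new. The mixed cases
        contradict that new points avoid the \<open>E\<close>-translates of \<open>N\<close>; here
        symmetry of \<open>E\<close> enters once more.\<close>
      consider "x \<in> M" "\<phi> e x \<in> M" | "x \<in> N" "\<phi> e x \<in> U n - (\<Union>e\<in>E. \<phi> e ` N)"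
        | "\<phi> e x \<in> N" "x \<in> U n - (\<Union>e\<in>E. \<phi> e ` N)" | "x \<in> U n" "\<phi> e x \<in> U n"
        using x MN unfolding M'_def by blast
      then show False
      proof cases
        case 1 then show ?thesis using Mdisj e unfolding translate_disjoint_def by blast
      next
        case 2 then show ?thesis using e by blast
      next
        case 3
        have "x \<in> \<phi> (inv e) ` N" using 3(1) ie(2) by (rule rev_image_eqI)
        then show ?thesis using 3(2) ie(1) by blast
      next
        case 4 then show ?thesis using Un(4) e unfolding translate_disjoint_def by blast
      qed
    qed
    moreover have "\<exists>g\<in>D'. \<exists>j<Suc n. \<phi> g x \<in> C j - U j" if x: "x \<in> N' - M'" for x
    proof -
      have xt: "x \<in> topspace X" using x sub unfolding N'_def by blast
      consider "x \<in> N - M" | "x \<in> C n - U n" | e where "e \<in> E" "x \<in> \<phi> e ` (N - M)"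
        using x unfolding M'_def N'_def by blast
      then show ?thesis
      proof cases
        case 1 then show ?thesis by (rule tie')
      next
        case 2
        then have "\<phi> \<one> x \<in> C n - U n" using act_one[OF xt] by simp
        moreover have "\<one> \<in> D'" unfolding D'_def by blast
        ultimately show ?thesis by blast
      next
        case 3 then show ?thesis using tieE[OF xt] by blast
      qed
    qed
    moreover have "(\<exists>g\<in>carrier G. \<phi> g x \<in> M') \<or> (\<exists>g\<in>D'. \<exists>j<Suc n. \<phi> g x \<in> C j - U j)"
      if i: "i < Suc n" and x: "x \<in> U i" for i x
    proof (cases "i < n")
      case True
      then consider g where "g \<in> carrier G" "\<phi> g x \<in> M" | g j where "g \<in> D" "j < n" "\<phi> g x \<in> C j - U j"
        using cov x by blast
      then show ?thesis
      proof cases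
        case 1 then show ?thesis unfolding M'_def by blast
      next
        case 2 then show ?thesis unfolding D'_def using less_SucI by blast
      qed
    next
      case False
      then have xU: "x \<in> U n" using i x by (simp add: less_Suc_eq)
      then have xt: "x \<in> topspace X" using sub by blast
      \<comment> \<open>If \<open>x\<close> was not added, it lies in some e N: either in e M, so
        that its orbit already meets \<open>M\<close>, or in the undecided part e (N - M), where a
        gap is near.\<close>
      consider "x \<in> M'" | e where "e \<in> E" "x \<in> \<phi> e ` M" | e where "e \<in> E" "x \<in> \<phi> e ` (N - M)"
        using xU unfolding M'_def by blast
      then show ?thesis
      proof cases
        case 1
        then have "\<phi> \<one> x \<in> M'" using act_one[OF xt] by simp
        then show ?thesis by blast
      next
        case 2
        then have "\<phi> (inv e) x \<in> M'"
          using mem_image_act[of e M x] E(2) sub(1) xt unfolding M'_def by auto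
        moreover have "inv e \<in> carrier G" using 2(1) E(2) by auto
        ultimately show ?thesis by blast
      next
        case 3 then show ?thesis using tieE[OF xt] by blast
      qed
    qed
    ultimately show ?thesis
      by (intro exI[of _ M'] exI[of _ N']) simp
  qed
  then show ?case
    using D'c D'fin by (intro exI[of _ D']) simp
qed

text \<open>Freeness and the Hausdorff property separate e x and x by disjoint open sets A and B;
  the points of B that e sends into A leave B. Intersecting over the finite set \<open>E\<close>
  gives \<open>V\<close>.\<close>

lemma translate_disjoint_nbhd:
  assumes haus: "Hausdorff_space X" and free: "free_action G X \<phi>"
    and E: "finite E" "E \<subseteq> carrier G - {\<one>}" and x: "x \<in> topspace X"
  shows "\<exists>V. openin X V \<and> x \<in> V \<and> translate_disjoint E V"
proof -
  have "\<exists>V. openin X V \<and> x \<in> V \<and> translate_disjoint {e} V" if e: "e \<in> E" for e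
  proof -
    have ec: "e \<in> carrier G" and "\<phi> e x \<noteq> x"
      using e E(2) free x unfolding free_action_def by auto
    then have "\<exists>A B. openin X A \<and> openin X B \<and> \<phi> e x \<in> A \<and> x \<in> B \<and> disjnt A B"
      using haus x act_closed[OF ec x] unfolding Hausdorff_space_def by blast
    then obtain A B where AB: "openin X A" "openin X B" "\<phi> e x \<in> A" "x \<in> B" "disjnt A B"
      by blast
    have "openin X {y \<in> topspace X. \<phi> e y \<in> A}"
      by (rule openin_continuous_map_preimage[OF homeomorphic_imp_continuous_map[OF homeo[OF ec]] AB(1)])
    then have "openin X (B \<inter> {y \<in> topspace X. \<phi> e y \<in> A})"
      using AB(2) by blast
    moreover have "x \<in> B \<inter> {y \<in> topspace X. \<phi> e y \<in> A}"
      using AB x by simp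
    moreover have "translate_disjoint {e} (B \<inter> {y \<in> topspace X. \<phi> e y \<in> A})"
      using AB(5) unfolding translate_disjoint_def disjnt_def by blast
    ultimately show ?thesis by blast
  qed
  then have "\<forall>e\<in>E. \<exists>V. openin X V \<and> x \<in> V \<and> translate_disjoint {e} V"
    by blast
  from bchoice[OF this] obtain V where V: "\<forall>e\<in>E. openin X (V e) \<and> x \<in> V e \<and> translate_disjoint {e} (V e)"
    by (rule exE)
  have "openin X ((\<Inter>e\<in>E. V e) \<inter> topspace X)"
    using V by (intro openin_INT E(1)) blast
  moreover have "x \<in> (\<Inter>e\<in>E. V e) \<inter> topspace X"
    using V x by blast
  moreover have "translate_disjoint E ((\<Inter>e\<in>E. V e) \<inter> topspace X)"
    using V unfolding translate_disjoint_def by blast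
  ultimately show ?thesis by blast
qed

lemma translate_disjoint_cover:
  assumes "compact_space X" and haus: "Hausdorff_space X" and free: "free_action G X \<phi>"
    and E: "finite E" "E \<subseteq> carrier G - {\<one>}"
  shows "\<exists>\<V>. finite \<V> \<and> (\<forall>V\<in>\<V>. openin X V \<and> translate_disjoint E V) \<and> topspace X \<subseteq> \<Union>\<V>"
proof -
  let ?\<U> = "{V. openin X V \<and> translate_disjoint E V}"
  have "topspace X \<subseteq> \<Union>?\<U>"
    using translate_disjoint_nbhd[OF haus free E] by blast
  then obtain \<V> where "finite \<V>" "\<V> \<subseteq> ?\<U>" "topspace X \<subseteq> \<Union>\<V>"
    using \<open>compact_space X\<close>[unfolded compact_space_alt, rule_format, of ?\<U>] by auto
  then show ?thesis by blast
qed

text \<open>A clash a g = b h forces g = a^-1 b h, so each step excludes only finitely many g. The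
  sets D h for h in H serve as disjoint regions of an orbit.\<close>

lemma exists_disjoint_right_translates:
  assumes "infinite (carrier G)" and D: "finite D" "D \<subseteq> carrier G"
  shows "\<exists>H. finite H \<and> card H = k \<and> H \<subseteq> carrier G \<and>
    (\<forall>h\<in>H. \<forall>h'\<in>H. \<forall>a\<in>D. \<forall>b\<in>D. a \<otimes> h = b \<otimes> h' \<longrightarrow> h = h')"
proof (induction k)
  case 0
  show ?case by (intro exI[of _ "{}"]) auto
next
  case (Suc k)
  then obtain H where H: "finite H" "card H = k" "H \<subseteq> carrier G"
      "\<forall>h\<in>H. \<forall>h'\<in>H. \<forall>a\<in>D. \<forall>b\<in>D. a \<otimes> h = b \<otimes> h' \<longrightarrow> h = h'"
    by blast
  define S where "S = H \<union> (\<lambda>(a, b, h). inv a \<otimes> (b \<otimes> h)) ` (D \<times> D \<times> H)"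
  have "finite S" unfolding S_def using D(1) H(1) by simp
  then obtain g where g: "g \<in> carrier G" "g \<notin> S"
    using assms(1) by (meson finite_subset subsetI)
  have no: "a \<otimes> g \<noteq> b \<otimes> h" if abh: "a \<in> D" "b \<in> D" "h \<in> H" for a b h
  proof
    assume eq: "a \<otimes> g = b \<otimes> h"
    have "a \<in> carrier G" using abh D(2) by blast
    then have "g = inv a \<otimes> (b \<otimes> h)"
      using eq g(1) by (metis inv_closed inv_solve_left m_closed abh(2,3) D(2) H(3) subsetD)
    then have "g \<in> S" unfolding S_def using abh by force
    then show False using g(2) by blast
  qed
  have "g \<notin> H" using g(2) unfolding S_def by blast
  moreover have "\<forall>h\<in>insert g H. \<forall>h'\<in>insert g H. \<forall>a\<in>D. \<forall>b\<in>D. a \<otimes> h = b \<otimes> h' \<longrightarrow> h = h'"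
  proof (intro ballI impI)
    fix h h' a b assume "h \<in> insert g H" "h' \<in> insert g H" and ab: "a \<in> D" "b \<in> D" "a \<otimes> h = b \<otimes> h'"
    then consider "h = g" "h' = g" | "h = g" "h' \<in> H" | "h \<in> H" "h' = g" | "h \<in> H" "h' \<in> H" by blast
    then show "h = h'"
    proof cases
      case 1 then show ?thesis by simp
    next
      case 2 then show ?thesis using no[OF ab(1,2)] ab(3) by blast
    next
      case 3 then show ?thesis using no[OF ab(2,1)] ab(3) by metis
    next
      case 4 then show ?thesis using H(4) ab by blast
    qed
  qed
  ultimately show ?case
    using H(1-3) g(1) by (intro exI[of _ "insert g H"]) simp
qed

text \<open>If the orbit of x missed the greedy set \<open>M\<close>, each of the
  \<open>d + 1\<close> regions D h would contain an element moving x into a gap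
  \<open>C j - U j\<close>. The regions are disjoint, so these are \<open>d + 1\<close> different
  incidences, one more than general position allows.\<close>

lemma finite_dim_marker_property:
  assumes compact: "compact_space X" and haus: "Hausdorff_space X" and free: "free_action G X \<phi>"
    and inf: "infinite (carrier G)" and dim: "covering_dim_le X d"
  shows "marker_property G X \<phi>"
  unfolding marker_property_def
proof (intro allI impI)
  fix F assume F: "finite F \<and> F \<subseteq> carrier G"
  have normal: "normal_space X"
    using compact haus compact_Hausdorff_or_regular_imp_normal_space by blast
  define E where "E = quotients F"
  have E: "finite E" "E \<subseteq> carrier G - {\<one>}" "\<forall>e\<in>E. inv e \<in> E"
    unfolding E_def using F finite_quotients quotients_closed inv_quotients by blast+
  have Ec: "E \<subseteq> carrier G" using E(2) by blast
  obtain \<V> where \<V>: "finite \<V>" "\<forall>V\<in>\<V>. openin X V \<and> translate_disjoint E V" "topspace X \<subseteq> \<Union>\<V>"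
    using translate_disjoint_cover[OF compact haus free E(1,2)] by blast
  obtain n and V :: "nat \<Rightarrow> 'x set" where "\<V> = V ` {i. i < n}"
    using finite_imp_nat_seg_image_inj_on[OF \<V>(1)] by blast
  then have V: "\<And>i. i < n \<Longrightarrow> openin X (V i)" "\<And>i. i < n \<Longrightarrow> translate_disjoint E (V i)"
      "topspace X \<subseteq> (\<Union>i\<in>{..<n}. V i)"
    using \<V> by auto
  have "\<exists>K. (\<forall>i\<in>{..<n}. closedin X (K i) \<and> K i \<subseteq> V i) \<and> topspace X \<subseteq> (\<Union>i\<in>{..<n}. K i)"
    using V by (intro normal_space_shrinking normal) auto
  then obtain K where K: "\<forall>i\<in>{..<n}. closedin X (K i) \<and> K i \<subseteq> V i" "topspace X \<subseteq> (\<Union>i\<in>{..<n}. K i)"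
    by (elim exE conjE)
  obtain D where D: "finite D" "D \<subseteq> carrier G" and greedy: "\<forall>U C.
      (\<forall>i<n. openin X (U i) \<and> closedin X (C i) \<and> U i \<subseteq> C i \<and> translate_disjoint E (U i)) \<longrightarrow>
      (\<exists>M N. openin X M \<and> closedin X N \<and> M \<subseteq> N \<and> translate_disjoint E M \<and>
        (\<forall>x\<in>N - M. \<exists>g\<in>D. \<exists>j<n. \<phi> g x \<in> C j - U j) \<and>
        (\<forall>i<n. \<forall>x\<in>U i. (\<exists>g\<in>carrier G. \<phi> g x \<in> M) \<or> (\<exists>g\<in>D. \<exists>j<n. \<phi> g x \<in> C j - U j)))"
    using greedy_marker[OF E(1) Ec E(3), of n] by (elim exE conjE)
  obtain H where H: "finite H" "card H = Suc d" "H \<subseteq> carrier G"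
      "\<forall>h\<in>H. \<forall>h'\<in>H. \<forall>a\<in>D. \<forall>b\<in>D. a \<otimes> h = b \<otimes> h' \<longrightarrow> h = h'"
    using exists_disjoint_right_translates[OF inf D, of "Suc d"] by (elim exE conjE)
  define W where "W = (\<lambda>(a, h). a \<otimes> h) ` (D \<times> H)"
  have W: "W \<subseteq> carrier G" "finite W"
    unfolding W_def using D H(1,3) by auto
  \<comment> \<open>General position is available on closed pieces with disjoint
    \<open>W\<close>-translates; shrinking this cover produces such pieces \<open>B V\<close>, and
    they still cover the space.\<close>
  obtain \<O> where \<O>: "finite \<O>" "\<forall>V\<in>\<O>. openin X V \<and> translate_disjoint (quotients W) V" "topspace X \<subseteq> \<Union>\<O>"
    using translate_disjoint_cover[OF compact haus free finite_quotients[OF W(2)] quotients_closed[OF W(1)]]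
    by (elim exE conjE)
  have "\<exists>B. (\<forall>V\<in>\<O>. closedin X (B V) \<and> B V \<subseteq> V) \<and> topspace X \<subseteq> (\<Union>V\<in>\<O>. B V)"
    using normal_space_shrinking[OF normal \<O>(1), of "\<lambda>V. V" "topspace X"] \<O>(2,3) by simp
  then obtain B where B: "\<forall>V\<in>\<O>. closedin X (B V) \<and> B V \<subseteq> V" "topspace X \<subseteq> (\<Union>V\<in>\<O>. B V)"
    by (elim exE conjE)
  have "\<exists>K' V'. (\<forall>i\<in>{..<n}. closedin X (K' i) \<and> openin X (V' i) \<and> K i \<subseteq> K' i \<and> K' i \<subseteq> V' i \<and> V' i \<subseteq> V i) \<and>
      (\<forall>Q\<in>B ` \<O>. \<forall>x\<in>Q. \<forall>J\<subseteq>W \<times> {..<n}. card J = Suc d \<longrightarrow> (\<exists>(g, i)\<in>J. \<phi> g x \<notin> V' i - K' i))"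
  proof (rule general_position[OF normal dim W])
    fix Q assume "Q \<in> B ` \<O>"
    then obtain V where VQ: "V \<in> \<O>" "Q = B V" by blast
    then show Q: "closedin X Q" using B(1) by blast
    have "translate_disjoint (quotients W) Q"
      using VQ B(1) \<O>(2) translate_disjoint_subset by blast
    then show "disjoint_family_on (\<lambda>g. \<phi> g ` Q) W"
      using disjoint_translates_iff[OF W(1)] closedin_subset[OF Q] by blast
  qed (use K(1) V(1) \<O>(1) in auto)
  then obtain K' V' where KV':
      "\<forall>i\<in>{..<n}. closedin X (K' i) \<and> openin X (V' i) \<and> K i \<subseteq> K' i \<and> K' i \<subseteq> V' i \<and> V' i \<subseteq> V i"
    and gp: "\<forall>Q\<in>B ` \<O>. \<forall>x\<in>Q. \<forall>J\<subseteq>W \<times> {..<n}. card J = Suc d \<longrightarrow> (\<exists>(g, i)\<in>J. \<phi> g x \<notin> V' i - K' i)"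
    by (elim exE conjE)
  \<comment> \<open>The sets for the greedy construction are chosen between \<open>K' i\<close> and
    \<open>V' i\<close>, so that their boundaries fall into the controlled sets
    \<open>V' i - K' i\<close>.\<close>
  have "\<forall>i\<in>{..<n}. \<exists>U. openin X U \<and> K' i \<subseteq> U \<and> X closure_of U \<subseteq> V' i"
    using normal[unfolded normal_space_alt] KV' by blast
  from bchoice[OF this] obtain U where U: "\<forall>i\<in>{..<n}. openin X (U i) \<and> K' i \<subseteq> U i \<and> X closure_of U i \<subseteq> V' i"
    by (rule exE)
  define C where "C i = X closure_of U i" for i
  have UC: "U i \<subseteq> C i" if "i < n" for i
    unfolding C_def using U that by (simp add: closure_of_subset openin_subset)
  have ties: "C i - U i \<subseteq> V' i - K' i" if "i < n" for i
    unfolding C_def using U that by blast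
  have "\<forall>i<n. openin X (U i) \<and> closedin X (C i) \<and> U i \<subseteq> C i \<and> translate_disjoint E (U i)"
  proof (intro allI impI)
    fix i assume i: "i < n"
    have "U i \<subseteq> V i"
      using U KV' UC[OF i] i unfolding C_def by (meson lessThan_iff order_trans)
    then show "openin X (U i) \<and> closedin X (C i) \<and> U i \<subseteq> C i \<and> translate_disjoint E (U i)"
      using U i UC[OF i] V(2)[OF i] translate_disjoint_subset unfolding C_def by auto
  qed
  from greedy[THEN spec, THEN spec, THEN mp, OF this]
  obtain M N where "openin X M \<and> closedin X N \<and> M \<subseteq> N \<and> translate_disjoint E M \<and>
      (\<forall>x\<in>N - M. \<exists>g\<in>D. \<exists>j<n. \<phi> g x \<in> C j - U j) \<and>
      (\<forall>i<n. \<forall>x\<in>U i. (\<exists>g\<in>carrier G. \<phi> g x \<in> M) \<or> (\<exists>g\<in>D. \<exists>j<n. \<phi> g x \<in> C j - U j))"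
    by (elim exE)
  then have M: "openin X M" "translate_disjoint E M" and
    cov: "\<forall>i<n. \<forall>x\<in>U i. (\<exists>g\<in>carrier G. \<phi> g x \<in> M) \<or> (\<exists>g\<in>D. \<exists>j<n. \<phi> g x \<in> C j - U j)"
    by simp_all
  have hits: "\<exists>g\<in>carrier G. \<phi> g x \<in> M" if x: "x \<in> topspace X" for x
  proof (rule ccontr)
    assume no: "\<not> (\<exists>g\<in>carrier G. \<phi> g x \<in> M)"
    have "\<forall>h\<in>H. \<exists>p. p \<in> D \<times> {..<n} \<and> \<phi> (fst p \<otimes> h) x \<in> C (snd p) - U (snd p)"
    proof
      fix h assume h: "h \<in> H"
      then have hc: "h \<in> carrier G" using H(3) by blast
      have "\<phi> h x \<in> topspace X" using act_closed[OF hc x] .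
      then obtain i where "i < n" "\<phi> h x \<in> U i" using K(2) KV' U by blast
      moreover have "\<phi> g (\<phi> h x) \<notin> M" if "g \<in> carrier G" for g
        using no act_mult[OF x that hc] m_closed[OF that hc] by metis
      ultimately obtain g j where gj: "g \<in> D" "j < n" "\<phi> g (\<phi> h x) \<in> C j - U j"
        using cov by blast
      then have "\<phi> (g \<otimes> h) x \<in> C j - U j"
        using act_mult[OF x _ hc] D(2) by auto
      then show "\<exists>p. p \<in> D \<times> {..<n} \<and> \<phi> (fst p \<otimes> h) x \<in> C (snd p) - U (snd p)"
        using gj(1,2) by (intro exI[of _ "(g, j)"]) simp
    qed
    from bchoice[OF this] obtain p where
      p: "\<forall>h\<in>H. p h \<in> D \<times> {..<n} \<and> \<phi> (fst (p h) \<otimes> h) x \<in> C (snd (p h)) - U (snd (p h))"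
      by blast
    \<comment> \<open>The incidence found in region D h: the group element and the index of the gap.
      Disjointness of the regions makes \<open>q\<close> injective.\<close>
    define q where "q h = (fst (p h) \<otimes> h, snd (p h))" for h
    have "inj_on q H"
    proof (rule inj_onI)
      fix h h' assume hh': "h \<in> H" "h' \<in> H" "q h = q h'"
      then have "fst (p h) \<otimes> h = fst (p h') \<otimes> h'" unfolding q_def by simp
      moreover have "fst (p h) \<in> D" "fst (p h') \<in> D"
        using p hh'(1,2) by (auto simp: mem_Times_iff)
      ultimately show "h = h'" using H(4) hh'(1,2) by blast
    qed
    then have "card (q ` H) = Suc d" using H(2) card_image by metis
    moreover have "q ` H \<subseteq> W \<times> {..<n}"
    proof
      fix z assume "z \<in> q ` H"
      then obtain h where h: "h \<in> H" "z = (fst (p h) \<otimes> h, snd (p h))" unfolding q_def by blast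
      then have "fst (p h) \<in> D" "snd (p h) < n" using p by (auto simp: mem_Times_iff)
      then show "z \<in> W \<times> {..<n}" using h unfolding W_def by auto
    qed
    moreover obtain Q where "Q \<in> B ` \<O>" "x \<in> Q" using B(2) x by blast
    ultimately have "\<exists>(g, i)\<in>q ` H. \<phi> g x \<notin> V' i - K' i"
      using gp[rule_format, of Q x "q ` H"] by simp
    then have "\<exists>h\<in>H. \<phi> (fst (p h) \<otimes> h) x \<notin> V' (snd (p h)) - K' (snd (p h))"
      by (simp only: q_def bex_simps case_prod_conv)
    then obtain h where h: "h \<in> H" "\<phi> (fst (p h) \<otimes> h) x \<notin> V' (snd (p h)) - K' (snd (p h))"
      by (rule bexE)
    then have "\<phi> (fst (p h) \<otimes> h) x \<in> C (snd (p h)) - U (snd (p h))" "snd (p h) < n"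
      using p by (auto simp: mem_Times_iff)
    then show False using ties h(2) by blast
  qed
  have "is_marker G X \<phi> F M"
    unfolding is_marker_def
  proof (intro conjI M(1))
    have Ms: "M \<subseteq> topspace X" using M(1) openin_subset by blast
    show "disjoint_family_on (\<lambda>g. \<phi> g ` M) F"
      using disjoint_translates_iff[OF _ Ms] F M(2) unfolding E_def by blast
    show "topspace X = (\<Union>g\<in>carrier G. \<phi> g ` M)"
    proof (intro equalityI subsetI)
      fix x assume x: "x \<in> topspace X"
      then obtain g where g: "g \<in> carrier G" "\<phi> g x \<in> M" using hits by blast
      then have "x \<in> \<phi> (inv g) ` M"
        using mem_image_act[of "inv g" M x] Ms x by simp
      then show "x \<in> (\<Union>g\<in>carrier G. \<phi> g ` M)" using g(1) by blast
    next
      fix x assume "x \<in> (\<Union>g\<in>carrier G. \<phi> g ` M)"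
      then show "x \<in> topspace X" using Ms act_closed by blast
    qed
  qed
  then show "\<exists>U. is_marker G X \<phi> F U" by blast
qed

text \<open>The points whose orbit misses a small neighbourhood \<open>V\<close> of x form a closed
  invariant set without x, hence the empty set by minimality. So \<open>V\<close> itself is a
  marker.\<close>

lemma minimal_marker_property:
  assumes haus: "Hausdorff_space X" and free: "free_action G X \<phi>"
    and min: "minimal_action G X \<phi>" and ne: "topspace X \<noteq> {}"
  shows "marker_property G X \<phi>"
  unfolding marker_property_def
proof (intro allI impI)
  fix F assume F: "finite F \<and> F \<subseteq> carrier G"
  obtain x where x: "x \<in> topspace X" using ne by blast
  obtain V where V: "openin X V" "x \<in> V" "translate_disjoint (quotients F) V"
    using translate_disjoint_nbhd[OF haus free finite_quotients quotients_closed x] F by blast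
  have Vs: "V \<subseteq> topspace X" using V(1) openin_subset by blast
  define C where "C = topspace X - (\<Union>g\<in>carrier G. \<phi> g ` V)"
  have C_iff: "y \<in> C \<longleftrightarrow> y \<in> topspace X \<and> (\<forall>g\<in>carrier G. \<phi> g y \<notin> V)" for y
  proof -
    have "(\<exists>g\<in>carrier G. y \<in> \<phi> g ` V) \<longleftrightarrow> (\<exists>g\<in>carrier G. \<phi> g y \<in> V)" if y: "y \<in> topspace X"
      using mem_image_act[OF _ Vs y] by (metis inv_closed inv_inv)
    then show ?thesis unfolding C_def by blast
  qed
  have "closedin X C"
    unfolding C_def using openin_image_act V(1) by (intro closedin_diff openin_Union) auto
  moreover have sub: "\<phi> g ` C \<subseteq> C" if g: "g \<in> carrier G" for g
  proof
    fix z assume "z \<in> \<phi> g ` C"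
    then obtain y where y: "y \<in> C" "z = \<phi> g y" by blast
    have yt: "y \<in> topspace X" using y C_iff by blast
    have "\<phi> h z \<notin> V" if h: "h \<in> carrier G" for h
      using y C_iff act_mult[OF yt h g] m_closed[OF h g] by metis
    then show "z \<in> C" using C_iff act_closed[OF g yt] y(2) by blast
  qed
  moreover have "\<phi> g ` C = C" if g: "g \<in> carrier G" for g
  proof
    show "C \<subseteq> \<phi> g ` C"
    proof
      fix y assume y: "y \<in> C"
      then have "\<phi> (inv g) y \<in> C" using sub[OF inv_closed[OF g]] by blast
      moreover have "y = \<phi> g (\<phi> (inv g) y)" using act_inv'[OF g] y C_iff by simp
      ultimately show "y \<in> \<phi> g ` C" by blast
    qed
  qed (rule sub[OF g])
  moreover have "C \<noteq> topspace X"
    using C_iff[of x] x V(2) act_one[OF x] one_closed by metis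
  ultimately have "C = {}"
    using min[unfolded minimal_action_def, THEN spec, of C] by metis
  then have "topspace X = (\<Union>g\<in>carrier G. \<phi> g ` V)"
    unfolding C_def using Vs act_closed by blast
  then have "is_marker G X \<phi> F V"
    unfolding is_marker_def using V(1,3) disjoint_translates_iff[OF _ Vs] F by blast
  then show "\<exists>U. is_marker G X \<phi> F U" by blast
qed

subsection \<open>Dynamic asymptotic dimension\<close>

text \<open>With a single set in the cover, that set is the whole space and no path ever leaves it.
  For \<open>E = {t}\<close> the return set then contains every positive power of \<open>t\<close>,
  and \<open>t\<close> has infinite order because \<open>C\<close> is finite.\<close>

lemma not_dad_le_0:
  assumes vc: "virtually_cyclic G" and inf: "infinite (carrier G)" and ne: "topspace X \<noteq> {}"
  shows "\<not> dad_le G X \<phi> 0"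
proof
  assume dad: "dad_le G X \<phi> 0"
  obtain t C where t: "t \<in> carrier G" and C: "finite C" "C \<subseteq> carrier G"
    and gen: "\<And>g. g \<in> carrier G \<Longrightarrow> \<exists>c\<in>C. \<exists>n::int. g = c \<otimes> t [^] n"
    using virtually_cyclic_cosets[OF vc] by metis
  have "infinite (range (\<lambda>n::int. t [^] n))"
  proof
    assume "finite (range (\<lambda>n::int. t [^] n))"
    moreover have "carrier G \<subseteq> (\<lambda>(c, p). c \<otimes> p) ` (C \<times> range (\<lambda>n::int. t [^] n))"
      using gen by fast
    ultimately show False using inf C(1) finite_subset by blast
  qed
  then have infP: "infinite ((\<lambda>n::nat. t [^] n) ` {1..})"
    by (rule infinite_nat_powers[OF t])
  obtain U where U: "\<forall>i\<le>0. openin X (U i)" "(\<Union>i\<le>0. U i) = topspace X"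
      "\<forall>i\<le>(0::nat). finite (return_set G \<phi> (U i) {t})"
    using dad[unfolded dad_le_def, THEN spec, of "{t}"] t by auto
  have U0: "U 0 = topspace X" using U(2) by simp
  obtain x where x: "x \<in> topspace X" using ne by blast
  have word: "left_word G (\<lambda>_. t) n = t [^] n" for n
  proof (induction n)
    case (Suc n)
    show ?case unfolding left_word.simps Suc by (rule nat_pow_Suc2[OF t, symmetric])
  qed simp
  have "t [^] n \<in> return_set G \<phi> (topspace X) {t}" if "n \<ge> 1" for n :: nat
    unfolding return_set_def
    using that t x word act_closed by (auto intro!: exI[of _ n] exI[of _ "\<lambda>_. t"] bexI[of _ x])
  then have "(\<lambda>n::nat. t [^] n) ` {1..} \<subseteq> return_set G \<phi> (U 0) {t}"
    unfolding U0 by auto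
  then show False using infP U(3) finite_subset by blast
qed

lemma return_set_subset:
  assumes "\<And>x n s. \<lbrakk>x \<in> U; \<forall>j\<in>{1..n}. s j \<in> E; \<forall>j\<in>{1..n}. \<phi> (left_word G s j) x \<in> U\<rbrakk>
    \<Longrightarrow> left_word G s n \<in> T"
  shows "return_set G \<phi> U E \<subseteq> T"
  unfolding return_set_def using assms by blast

text \<open>Only finitely many products e c occur, so their exponents are bounded. Multiplying c t^q
  by e on the left then moves the exponent q by at most \<open>L\<close>.\<close>

lemma coset_shift_bound:
  assumes "finite E" "E \<subseteq> carrier G" and C: "finite C" "C \<subseteq> carrier G"
    and gen: "\<And>g. g \<in> carrier G \<Longrightarrow> \<exists>c\<in>C. \<exists>n::int. g = c \<otimes> t [^] n"
  obtains L :: int where "0 \<le> L"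
    and "\<And>e c. \<lbrakk>e \<in> E; c \<in> C\<rbrakk> \<Longrightarrow> \<exists>c'\<in>C. \<exists>k. \<bar>k\<bar> \<le> L \<and> e \<otimes> c = c' \<otimes> t [^] k"
proof -
  have "\<forall>p\<in>E \<times> C. \<exists>k::int. \<exists>c'\<in>C. fst p \<otimes> snd p = c' \<otimes> t [^] k"
  proof
    fix p assume "p \<in> E \<times> C"
    then have "fst p \<otimes> snd p \<in> carrier G"
      using assms(2) C(2) by (auto simp: mem_Times_iff)
    then show "\<exists>k::int. \<exists>c'\<in>C. fst p \<otimes> snd p = c' \<otimes> t [^] k" using gen by blast
  qed
  from bchoice[OF this] obtain k :: "'g \<times> 'g \<Rightarrow> int"
    where k: "\<forall>p\<in>E \<times> C. \<exists>c'\<in>C. fst p \<otimes> snd p = c' \<otimes> t [^] k p"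
    by (rule exE)
  \<comment> \<open>Inserting 0 keeps the maximum defined when \<open>E\<close> is empty and makes
    \<open>L\<close> non-negative.\<close>
  define L where "L = Max (insert 0 ((\<lambda>p. \<bar>k p\<bar>) ` (E \<times> C)))"
  have fin: "finite (insert 0 ((\<lambda>p. \<bar>k p\<bar>) ` (E \<times> C)))"
    using assms(1) C(1) by simp
  have "0 \<le> L" unfolding L_def using fin by (intro Max_ge) auto
  moreover have "\<exists>c'\<in>C. \<exists>k. \<bar>k\<bar> \<le> L \<and> e \<otimes> c = c' \<otimes> t [^] k" if ec: "e \<in> E" "c \<in> C" for e c
  proof -
    have "\<bar>k (e, c)\<bar> \<le> L" unfolding L_def using fin ec by (intro Max_ge) auto
    moreover have "\<exists>c'\<in>C. e \<otimes> c = c' \<otimes> t [^] k (e, c)" using k ec by force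
    ultimately show ?thesis by blast
  qed
  ultimately show ?thesis using that by blast
qed

text \<open>Elements whose exponents differ by at most \<open>L\<close>, the bound for one \<open>E\<close>-step, differ by left
  multiplication with an element of \<open>B\<close>. So an \<open>E\<close>-path in the complement of \<open>B K\<close> cannot jump
  over a visit to \<open>K\<close> and is trapped between two consecutive ones.\<close>

lemma marker_imp_dad_le_1:
  assumes vc: "virtually_cyclic G" and compact: "compact_space X" and haus: "Hausdorff_space X"
    and marker: "marker_property G X \<phi>"
  shows "dad_le G X \<phi> 1"
  unfolding dad_le_def
proof (intro allI impI)
  fix E assume E: "finite E \<and> E \<subseteq> carrier G"
  have normal: "normal_space X"
    using compact haus compact_Hausdorff_or_regular_imp_normal_space by blast
  obtain t C where t: "t \<in> carrier G" and C: "finite C" "C \<subseteq> carrier G"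
    and gen: "\<And>g. g \<in> carrier G \<Longrightarrow> \<exists>c\<in>C. \<exists>n::int. g = c \<otimes> t [^] n"
    using virtually_cyclic_cosets[OF vc] by metis
  obtain L :: int where L: "0 \<le> L"
    and shift: "\<And>e c. \<lbrakk>e \<in> E; c \<in> C\<rbrakk> \<Longrightarrow> \<exists>c'\<in>C. \<exists>k. \<bar>k\<bar> \<le> L \<and> e \<otimes> c = c' \<otimes> t [^] k"
    using coset_shift_bound[of E C t] E C gen by metis
  define B where "B = (\<lambda>(c, k, c'). c \<otimes> t [^] k \<otimes> inv c') ` (C \<times> {-L..L} \<times> C)"
  have B: "finite B" "B \<subseteq> carrier G"
    unfolding B_def using C t by auto
  \<comment> \<open>Disjointness over \<open>F\<close> is tailored to one step between balls: if e b
    y lies in b' U with y in \<open>U\<close>, then b'^-1 e b = 1. \<open>\<one>\<close> is included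
    as the element to compare with.\<close>
  define F where "F = insert \<one> ((\<lambda>(a, e, b). inv a \<otimes> (e \<otimes> b)) ` (B \<times> E \<times> B))"
  have F: "finite F" "F \<subseteq> carrier G"
    unfolding F_def using B E by auto
  obtain U where U: "is_marker G X \<phi> F U"
    using marker F unfolding marker_property_def by blast
  have Uo: "openin X U" and Ud: "disjoint_family_on (\<lambda>g. \<phi> g ` U) F"
    and Uc: "topspace X = (\<Union>g\<in>carrier G. \<phi> g ` U)"
    using U unfolding is_marker_def by blast+
  have Us: "U \<subseteq> topspace X" using Uo openin_subset by blast
  have sparse: "r = \<one>" if r: "r \<in> F" "y \<in> U" "\<phi> r y \<in> U" for r y
  proof (rule ccontr)
    assume "r \<noteq> \<one>"
    moreover have "\<one> \<in> F" unfolding F_def by blast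
    ultimately have "\<phi> r ` U \<inter> \<phi> \<one> ` U = {}"
      using Ud r(1) unfolding disjoint_family_on_def by blast
    moreover have "\<phi> r y \<in> \<phi> \<one> ` U"
      using r Us act_one[of "\<phi> r y"] by (metis image_eqI subsetD)
    ultimately show False using r(2) by blast
  qed
  have "\<exists>\<F>. finite \<F> \<and> \<F> \<subseteq> (\<lambda>g. \<phi> g ` U) ` carrier G \<and> topspace X \<subseteq> \<Union>\<F>"
    using compact[unfolded compact_space_alt, rule_format, of "(\<lambda>g. \<phi> g ` U) ` carrier G"]
      openin_image_act Uo Uc by auto
  then obtain \<F> where "finite \<F>" "\<F> \<subseteq> (\<lambda>g. \<phi> g ` U) ` carrier G" "topspace X \<subseteq> \<Union>\<F>"
    by blast
  then obtain S where S: "finite S" "S \<subseteq> carrier G" "topspace X \<subseteq> (\<Union>g\<in>S. \<phi> g ` U)"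
    using finite_subset_image by metis
  have "\<exists>Q. (\<forall>g\<in>S. closedin X (Q g) \<and> Q g \<subseteq> \<phi> g ` U) \<and> topspace X \<subseteq> (\<Union>g\<in>S. Q g)"
    using S openin_image_act Uo by (intro normal_space_shrinking[OF normal]) auto
  then obtain Q where Q: "\<forall>g\<in>S. closedin X (Q g) \<and> Q g \<subseteq> \<phi> g ` U" "topspace X \<subseteq> (\<Union>g\<in>S. Q g)"
    by (elim exE conjE)
  \<comment> \<open>The closed sets \<open>Q g\<close> are pulled back into \<open>U\<close>:
    \<open>K\<close> is a closed part of the marker that every point still reaches through an
    inverse of an element of the finite set \<open>S\<close>.\<close>
  define K where "K = (\<Union>g\<in>S. \<phi> (inv g) ` Q g)"
  have Kc: "closedin X K"
    unfolding K_def using S(1,2) Q(1) closedin_image_act by (intro closedin_Union) auto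
  have KU: "K \<subseteq> U"
  proof
    fix y assume "y \<in> K"
    then obtain g z where gz: "g \<in> S" "z \<in> Q g" "y = \<phi> (inv g) z" unfolding K_def by blast
    then have "z \<in> \<phi> g ` U" using Q(1) by blast
    then show "y \<in> U"
      using gz S(2) mem_image_act[of g U z] Us act_closed by blast
  qed
  have Khit: "\<exists>g\<in>S. \<phi> (inv g) y \<in> K" if "y \<in> topspace X" for y
    using Q(2) that unfolding K_def by blast
  \<comment> \<open>The open balls are built on \<open>U\<close>, the removed closed balls on the
    smaller set \<open>K\<close>; this makes both sets open and lets them cover the space.\<close>
  define U0 where "U0 = (\<Union>b\<in>B. \<phi> b ` U)"
  define U1 where "U1 = topspace X - (\<Union>b\<in>B. \<phi> b ` K)"
  have U0: "openin X U0"
    unfolding U0_def using B(2) Uo openin_image_act by (intro openin_Union) auto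
  have U1: "openin X U1"
    unfolding U1_def using B Kc closedin_image_act by (intro openin_diff closedin_Union) auto
  have U01: "U0 \<union> U1 = topspace X"
    using openin_subset[OF U0] KU unfolding U0_def U1_def by blast
  have U0_sub: "U0 \<subseteq> topspace X" using openin_subset[OF U0] .

  \<comment> \<open>The return set of the balls\<close>
  have "return_set G \<phi> U0 E \<subseteq> (\<lambda>(a, b). a \<otimes> inv b) ` (B \<times> B)"
  proof (rule return_set_subset)
    fix x n s assume x: "x \<in> U0" and s: "\<forall>j\<in>{1..n}. s j \<in> E"
      and path: "\<forall>j\<in>{1..n}. \<phi> (left_word G s j) x \<in> U0"
    have xt: "x \<in> topspace X" using x U0_sub by blast
    obtain b0 where b0: "b0 \<in> B" "x \<in> \<phi> b0 ` U" using x unfolding U0_def by blast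
    then have b0c: "b0 \<in> carrier G" using B by blast
    define y where "y = \<phi> (inv b0) x"
    have yU: "y \<in> U" unfolding y_def using mem_image_act[OF b0c Us xt] b0(2) by blast
    then have yt: "y \<in> topspace X" using Us by blast
    have xy: "x = \<phi> b0 y" unfolding y_def using act_inv'[OF b0c xt] by simp
    \<comment> \<open>The path never leaves the ball of the one visit y: by sparseness, a step into
      the ball b' U must have s b = b', so the word keeps the form b b0^-1.\<close>
    have "\<exists>b\<in>B. left_word G s j = b \<otimes> inv b0" if "j \<le> n" for j
      using that
    proof (induction j)
      case 0
      then show ?case using b0 b0c by (intro bexI[of _ b0]) auto
    next
      case (Suc j)
      then obtain b where b: "b \<in> B" "left_word G s j = b \<otimes> inv b0" by auto
      have bc: "b \<in> carrier G" using b(1) B(2) by blast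
      have e: "s (Suc j) \<in> E" using s Suc.prems by simp
      then have ec: "s (Suc j) \<in> carrier G" using E by blast
      have "\<phi> (left_word G s (Suc j)) x \<in> U0"
        using Suc.prems by (intro bspec[OF path]) simp
      moreover have "\<phi> (left_word G s (Suc j)) x = \<phi> (s (Suc j) \<otimes> b) y"
        unfolding xy using b b0c bc ec yt by (simp flip: act_mult add: m_assoc)
      ultimately obtain b' where b': "b' \<in> B" "\<phi> (s (Suc j) \<otimes> b) y \<in> \<phi> b' ` U"
        unfolding U0_def by auto
      have b'c: "b' \<in> carrier G" using b'(1) B(2) by blast
      have "\<phi> (inv b') (\<phi> (s (Suc j) \<otimes> b) y) \<in> U"
        using mem_image_act[OF b'c Us, of "\<phi> (s (Suc j) \<otimes> b) y"] b'(2) act_closed[OF _ yt] ec bc by auto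
      then have "\<phi> (inv b' \<otimes> (s (Suc j) \<otimes> b)) y \<in> U"
        using act_mult[OF yt, of "inv b'" "s (Suc j) \<otimes> b"] ec bc b'c by simp
      moreover have "inv b' \<otimes> (s (Suc j) \<otimes> b) \<in> F"
        unfolding F_def using b'(1) b(1) e by force
      ultimately have "inv b' \<otimes> (s (Suc j) \<otimes> b) = \<one>" using sparse yU by blast
      then have "s (Suc j) \<otimes> b = b'"
        using b'c ec bc by (metis inv_solve_left m_closed one_closed r_one)
      then have "left_word G s (Suc j) = b' \<otimes> inv b0"
        using b(2) ec bc b0c by (simp flip: m_assoc)
      then show ?case using b'(1) by blast
    qed
    then obtain b where "b \<in> B" "left_word G s n = b \<otimes> inv b0" by blast
    then show "left_word G s n \<in> (\<lambda>(a, b). a \<otimes> inv b) ` (B \<times> B)" using b0(1) by force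
  qed
  then have fin0: "finite (return_set G \<phi> U0 E)"
    using B(1) finite_subset by (metis finite_cartesian_product finite_imageI)

  \<comment> \<open>The return set of the complement of the closed balls\<close>
  obtain c0 and k0 :: int where c0: "c0 \<in> C" "\<one> = c0 \<otimes> t [^] k0" using gen[OF one_closed] by blast
  have c0c: "c0 \<in> carrier G" using c0 C by blast
  have invS: "finite ((\<lambda>g. inv g) ` S)" "(\<lambda>g. inv g) ` S \<subseteq> carrier G" using S by auto
  obtain R :: int where R: "0 \<le> R"
    and shiftS: "\<And>e c. \<lbrakk>e \<in> (\<lambda>g. inv g) ` S; c \<in> C\<rbrakk> \<Longrightarrow> \<exists>c'\<in>C. \<exists>k. \<bar>k\<bar> \<le> R \<and> e \<otimes> c = c' \<otimes> t [^] k"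
    using coset_shift_bound[OF invS C gen] by metis
  have shift_pow: "e \<otimes> (c \<otimes> t [^] q) = c' \<otimes> t [^] (k + q)"
    if "e \<in> carrier G" "c \<in> carrier G" "c' \<in> carrier G" "e \<otimes> c = c' \<otimes> t [^] k" for e c c' and q k :: int
  proof -
    have "e \<otimes> (c \<otimes> t [^] q) = (e \<otimes> c) \<otimes> t [^] q" using that(1,2) t by (simp add: m_assoc)
    also have "\<dots> = c' \<otimes> t [^] (k + q)" unfolding that(4) using that t by (simp add: m_assoc int_pow_mult)
    finally show ?thesis .
  qed
  \<comment> \<open>From the point c0 t^m x some inverse of an element of \<open>S\<close> leads to
    \<open>K\<close>, and this changes the exponent m by at most \<open>R\<close>.\<close>
  have visit: "\<exists>c\<in>C. \<exists>p. \<bar>p - m\<bar> \<le> R \<and> \<phi> (c \<otimes> t [^] p) x \<in> K" if x: "x \<in> topspace X" for m x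
  proof -
    have wc: "c0 \<otimes> t [^] m \<in> carrier G" using c0c t by simp
    obtain g where g: "g \<in> S" "\<phi> (inv g) (\<phi> (c0 \<otimes> t [^] m) x) \<in> K"
      using Khit[OF act_closed[OF wc x]] by blast
    then have gc: "inv g \<in> carrier G" using S(2) by auto
    obtain c k where ck: "c \<in> C" "\<bar>k\<bar> \<le> R" "inv g \<otimes> c0 = c \<otimes> t [^] k"
      using shiftS[of "inv g" c0] g(1) c0(1) by blast
    have "inv g \<otimes> (c0 \<otimes> t [^] m) = c \<otimes> t [^] (k + m)"
      using gc c0c ck C(2) by (intro shift_pow) auto
    then have "\<phi> (c \<otimes> t [^] (k + m)) x \<in> K" using g(2) act_mult[OF x gc wc] by simp
    then show ?thesis using ck(1,2) by (intro bexI[of _ c] exI[of _ "k + m"]) auto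
  qed
  \<comment> \<open>The path starts at the identity, which has exponent \<open>k0\<close>; the
    interval contains all exponents between the two visits \<open>p1\<close> and \<open>p2\<close>
    chosen below.\<close>
  define T where "T = (\<lambda>(c, q). c \<otimes> t [^] q) ` (C \<times> {k0 - 2 * R - 1..k0 + 2 * R + 1})"
  have "return_set G \<phi> U1 E \<subseteq> T"
  proof (rule return_set_subset)
    fix x n s assume x: "x \<in> U1" and s: "\<forall>j\<in>{1..n}. s j \<in> E"
      and path: "\<forall>j\<in>{1..n}. \<phi> (left_word G s j) x \<in> U1"
    have xt: "x \<in> topspace X" using x unfolding U1_def by blast
    \<comment> \<open>Aiming \<open>R + 1\<close> below and above \<open>k0\<close> with error at
      most \<open>R\<close> guarantees p1 < k0 < p2.\<close>
    obtain a1 p1 where a1: "a1 \<in> C" "\<bar>p1 - (k0 - R - 1)\<bar> \<le> R" "\<phi> (a1 \<otimes> t [^] p1) x \<in> K"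
      using visit[OF xt] by blast
    obtain a2 p2 where a2: "a2 \<in> C" "\<bar>p2 - (k0 + R + 1)\<bar> \<le> R" "\<phi> (a2 \<otimes> t [^] p2) x \<in> K"
      using visit[OF xt] by blast
    \<comment> \<open>Exponents at distance at most \<open>L\<close> would give a quotient in
      \<open>B\<close> and place the point in a removed ball.\<close>
    have far: "\<bar>q - p\<bar> > L"
      if a: "a \<in> C" "\<phi> (a \<otimes> t [^] p) x \<in> K" and c: "c \<in> C" "\<phi> (c \<otimes> t [^] q) x \<in> U1" for a p c q
    proof (rule ccontr)
      assume "\<not> \<bar>q - p\<bar> > L"
      then have inB: "c \<otimes> t [^] (q - p) \<otimes> inv a \<in> B"
        unfolding B_def using a(1) c(1) by (intro image_eqI[of _ _ "(c, q - p, a)"]) auto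
      have ac: "a \<in> carrier G" "c \<in> carrier G" using a c C by auto
      have "c \<otimes> t [^] (q - p) \<otimes> inv a \<otimes> (a \<otimes> t [^] p) = c \<otimes> t [^] (q - p) \<otimes> (inv a \<otimes> a) \<otimes> t [^] p"
        using ac t by (simp only: m_assoc inv_closed m_closed int_pow_closed)
      also have "\<dots> = c \<otimes> t [^] q"
        using int_pow_mult[OF t, of "q - p" p] ac t by (simp add: m_assoc)
      finally have "\<phi> (c \<otimes> t [^] q) x = \<phi> (c \<otimes> t [^] (q - p) \<otimes> inv a) (\<phi> (a \<otimes> t [^] p) x)"
        using ac t xt by (simp flip: act_mult)
      then show False using inB a(2) c(2) unfolding U1_def by blast
    qed
    have "\<exists>c\<in>C. \<exists>q. left_word G s j = c \<otimes> t [^] q \<and> p1 < q \<and> q < p2" if "j \<le> n" for j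
      using that
    proof (induction j)
      case 0
      then show ?case using c0 a1(2) a2(2) R by (intro bexI[of _ c0] exI[of _ k0]) auto
    next
      case (Suc j)
      then obtain c q where cq: "c \<in> C" "left_word G s j = c \<otimes> t [^] q" "p1 < q" "q < p2" by auto
      have e: "s (Suc j) \<in> E" using s Suc.prems by simp
      then obtain c' k where ck: "c' \<in> C" "\<bar>k\<bar> \<le> L" "s (Suc j) \<otimes> c = c' \<otimes> t [^] k"
        using shift cq(1) by blast
      have "s (Suc j) \<otimes> (c \<otimes> t [^] q) = c' \<otimes> t [^] (k + q)"
        using e E cq(1) ck C(2) by (intro shift_pow) auto
      then have w: "left_word G s (Suc j) = c' \<otimes> t [^] (k + q)" using cq(2) by simp
      moreover have "\<phi> (left_word G s (Suc j)) x \<in> U1"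
        using Suc.prems by (intro bspec[OF path]) simp
      ultimately have "\<phi> (c' \<otimes> t [^] (k + q)) x \<in> U1" by simp
      then have "\<bar>k + q - p1\<bar> > L" "\<bar>k + q - p2\<bar> > L"
        using far[OF a1(1,3) ck(1)] far[OF a2(1,3) ck(1)] by blast+
      \<comment> \<open>A step moves the exponent by at most \<open>L\<close>, while the new
        exponent is more than \<open>L\<close> away from both visits, so neither can be
        passed.\<close>
      then have "p1 < k + q" "k + q < p2" using ck(2) cq(3,4) by linarith+
      then show ?case using w ck(1) by blast
    qed
    then obtain c q where "c \<in> C" "left_word G s n = c \<otimes> t [^] q" "p1 < q" "q < p2" by blast
    then show "left_word G s n \<in> T"
      unfolding T_def using a1(2) a2(2) by (intro image_eqI[of _ _ "(c, q)"]) auto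
  qed
  moreover have "finite T" unfolding T_def using C(1) by simp
  ultimately have fin1: "finite (return_set G \<phi> U1 E)" using finite_subset by blast
  show "\<exists>U :: nat \<Rightarrow> 'x set. (\<forall>i\<le>1. openin X (U i)) \<and> (\<Union>i\<le>1. U i) = topspace X \<and>
      (\<forall>i\<le>1. finite (return_set G \<phi> (U i) E))"
  proof (intro exI[of _ "\<lambda>i. if i = 0 then U0 else U1"] conjI)
    have "{..1::nat} = {0, 1}" by auto
    then show "(\<Union>i\<le>1::nat. if i = 0 then U0 else U1) = topspace X"
      using U01 by (simp add: Un_commute)
  qed (use U0 U1 fin0 fin1 in auto)
qed

lemma marker_imp_dad_eq_1:
  assumes "virtually_cyclic G" and "infinite (carrier G)" and "compact_space X"
    and "Hausdorff_space X" and "topspace X \<noteq> {}" and "marker_property G X \<phi>"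
  shows "dad G X \<phi> = 1"
proof -
  have le: "dad_le G X \<phi> 1" by (rule marker_imp_dad_le_1[OF assms(1,3,4,6)])
  have "(LEAST d. dad_le G X \<phi> d) = 1"
  proof (rule Least_equality[of "dad_le G X \<phi>", OF le])
    fix d assume "dad_le G X \<phi> d"
    then show "1 \<le> d" using not_dad_le_0[OF assms(1,2,5)] by (cases d) auto
  qed
  then show ?thesis unfolding dad_def using le by (auto simp: one_enat_def)
qed

end

theorem theorem2p2:
  fixes G :: "('g, 'm) monoid_scheme"
    and X :: "'x topology"
    and \<phi> :: "'g \<Rightarrow> 'x \<Rightarrow> 'x"
  assumes "group G"
    and "infinite (carrier G)"
    and "virtually_cyclic G"
    and "compact_space X"
    and "Hausdorff_space X"
    and "topspace X \<noteq> {}"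
    and "action_by_homeomorphisms G X \<phi>"
  shows "(marker_property G X \<phi> \<longrightarrow> dad G X \<phi> = 1) \<and>
         (free_action G X \<phi> \<and> (minimal_action G X \<phi> \<or> covering_dim X < \<infinity>) \<longrightarrow>
            marker_property G X \<phi> \<and> dad G X \<phi> = 1)"
proof -
  interpret homeo_action G X \<phi>
    using assms(7) unfolding action_by_homeomorphisms_def
    by (auto simp: homeo_action_def homeo_action_axioms_def)
  have dad: "marker_property G X \<phi> \<Longrightarrow> dad G X \<phi> = 1"
    by (rule marker_imp_dad_eq_1[OF assms(3,2,4,5,6)])
  moreover have "marker_property G X \<phi>"
    if free: "free_action G X \<phi>" and "minimal_action G X \<phi> \<or> covering_dim X < \<infinity>"
    using that(2)
  proof
    assume "minimal_action G X \<phi>"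
    then show ?thesis by (rule minimal_marker_property[OF assms(5) free _ assms(6)])
  next
    assume "covering_dim X < \<infinity>"
    then obtain d where "covering_dim_le X d"
      unfolding covering_dim_def by (auto split: if_splits)
    then show ?thesis by (rule finite_dim_marker_property[OF assms(4,5) free assms(2)])
  qed
  ultimately show ?thesis by blast
qed

end
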